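(* For every integer $n \ge 2$, the graph (1-skeleton) of the $n$-dimensional associahedron of type $D_n$ has diameter exactly $2n-2$. Equivalently, in the combinatorial model described in the context, the flip graph on centrally symmetric pseudotriangulations of $\mathcal{D}_n$ has diameter exactly $2n-2$.
   Context: The type $D_n$ associahedron is the Fomin–Zelevinsky generalized associahedron of the Weyl group $D_n$; its graph is isomorphic to the following flip graph. Let $\mathcal{D}_n$ be the configuration consisting of a regular convex $2n$-gon together with a closed disk $\mathbb{D}$ centered at the center of the polygon, with radius small enough that $\mathbb{D}$ meets only the long diagonals (those joining opposite vertices) of the $2n$-gon. Label the vertices counterclockwise $0,1,\dots,n-1,\bar 0,\bar 1,\dots,\overline{n-1}$, so that $p$ and $\bar p$ are symmetric with respect to the center. The chords of $\mathcal{D}_n$ are: all diagonals of the $2n$-gon except the long ones, together with the segments with one endpoint at a vertex of the $2n$-gon and tangent to $\mathbb{D}$. Each vertex $p$ is the endpoint of two such tangent chords: $p^{L}$, passing tangent to $\mathbb{D}$ on its left, and $p^{R}$, passing tangent on its right (these are called central chords). Two chords cross if their relative interiors intersect. A centrally symmetric pseudotriangulation of $\mathcal{D}_n$ is an inclusion-maximal crossing-free set of chords that is invariant under the central symmetry; it contains exactly $2n$ chords (i.e. $n$ centrally symmetric pairs) and decomposes the convex hull of the polygon minus $\mathbb{D}$ into pseudotriangles. A flip replaces one centrally symmetric pair of chords of such a pseudotriangulation by the unique other centrally symmetric pair of chords yielding again a centrally symmetric pseudotriangulation. The flip graph has these pseudotriangulations as vertices and flips as edges. *)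

theory Defs
  imports "HOL-Analysis.Analysis" "Graph_Theory.Graph_Theory"
begin

text \<open>
  The configuration is normalised: the polygon is the regular \<open>2n\<close>-gon inscribed in the complex
  unit circle, and the disk is \<^term>\<open>cball (0::complex) r\<close>.  For \<open>p < n\<close>, the vertex with index
  \<open>p\<close> is \<open>p\<close> itself and the vertex with index \<open>n + p\<close> is \<open>p\<close>-bar.  The central symmetry is
  \<^term>\<open>uminus :: complex \<Rightarrow> complex\<close>.  Chords are segments, represented as sets of points.
\<close>

definition vertex :: "nat \<Rightarrow> nat \<Rightarrow> complex" where
  "vertex n k = cis (pi * real k / real n)"

text \<open>
  The segments avoided by the disk include the sides of the polygon.  This only matters for
  \<open>n = 2\<close>, where the square has no other non-long segment to confine the disk to its interior.
\<close>

definition admissible_radius :: "nat \<Rightarrow> real \<Rightarrow> bool" where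
  "admissible_radius n r \<longleftrightarrow> 0 < r \<and>
     (\<forall>i j. i < j \<and> j < 2 * n \<and> j - i \<noteq> n \<longrightarrow>
        closed_segment (vertex n i) (vertex n j) \<inter> cball 0 r = {})"

definition diagonal_chords :: "nat \<Rightarrow> complex set set" where
  "diagonal_chords n =
     {closed_segment (vertex n i) (vertex n j) | i j.
        i < j \<and> j < 2 * n \<and> j - i \<notin> {1, n, 2 * n - 1}}"

text \<open>
  A central chord runs from a vertex to its point of tangency \<open>t\<close> with the disk and stops there;
  tangency at \<open>t\<close> is orthogonality of the segment to the radius.  Each vertex has two such points
  \<open>t\<close>, one for \<open>p\<close>-superscript-\<open>L\<close> and one for \<open>p\<close>-superscript-\<open>R\<close>.
\<close>

definition central_chords :: "nat \<Rightarrow> real \<Rightarrow> complex set set" where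
  "central_chords n r =
     {closed_segment (vertex n k) t | k t.
        k < 2 * n \<and> norm t = r \<and> orthogonal t (vertex n k - t)}"

definition chords :: "nat \<Rightarrow> real \<Rightarrow> complex set set" where
  "chords n r = diagonal_chords n \<union> central_chords n r"

definition crossing :: "complex set \<Rightarrow> complex set \<Rightarrow> bool" where
  "crossing c d \<longleftrightarrow> rel_interior c \<inter> rel_interior d \<noteq> {}"

definition crossing_free :: "complex set set \<Rightarrow> bool" where
  "crossing_free T \<longleftrightarrow> pairwise (\<lambda>c d. \<not> crossing c d) T"

definition cs_pseudotriangulation :: "nat \<Rightarrow> real \<Rightarrow> complex set set \<Rightarrow> bool" where
  "cs_pseudotriangulation n r T \<longleftrightarrow>
     T \<subseteq> chords n r \<and> crossing_free T \<and>
     (\<forall>S. S \<subseteq> chords n r \<and> crossing_free S \<and> T \<subseteq> S \<longrightarrow> S = T) \<and>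
     (\<forall>c\<in>T. uminus ` c \<in> T)"

definition cs_pair :: "complex set \<Rightarrow> complex set set" where
  "cs_pair c = {c, uminus ` c}"

definition flip :: "nat \<Rightarrow> real \<Rightarrow> complex set set \<Rightarrow> complex set set \<Rightarrow> bool" where
  "flip n r T T' \<longleftrightarrow>
     cs_pseudotriangulation n r T \<and> cs_pseudotriangulation n r T' \<and>
     (\<exists>c\<in>T. \<exists>d. d \<notin> T \<and> T' = (T - cs_pair c) \<union> cs_pair d)"

definition flip_graph :: "nat \<Rightarrow> real \<Rightarrow> complex set set pair_pre_digraph" where
  "flip_graph n r =
     \<lparr>pverts = {T. cs_pseudotriangulation n r T}, parcs = {(T, T'). flip n r T T'}\<rparr>"

text \<open>
  With unit weights, \<open>wf_digraph.\<mu>\<close> is the number of arcs of a shortest walk, and \<open>\<infinity>\<close> if there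
  is none; so a disconnected graph has infinite diameter.
\<close>

definition graph_distance :: "('a, 'b) pre_digraph \<Rightarrow> 'a \<Rightarrow> 'a \<Rightarrow> ereal" where
  "graph_distance G u v = wf_digraph.\<mu> G (\<lambda>_. 1) u v"

definition diameter_of_graph :: "('a, 'b) pre_digraph \<Rightarrow> ereal" where
  "diameter_of_graph G = (SUP u\<in>verts G. SUP v\<in>verts G. graph_distance G u v)"

lemma uminus_image_uminus_image [simp]: "uminus ` uminus ` (c :: complex set) = c"
  by (simp add: image_image)

lemma flip_sym:
  assumes "flip n r T T'" shows "flip n r T' T"
proof -
  from assms obtain c d where c: "c \<in> T" and d: "d \<notin> T"
    and T': "T' = (T - cs_pair c) \<union> cs_pair d"
    and pt: "cs_pseudotriangulation n r T" "cs_pseudotriangulation n r T'"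
    unfolding flip_def by blast
  have inv: "uminus ` x \<in> T" if "x \<in> T" for x
    using pt(1) that unfolding cs_pseudotriangulation_def by blast
  have "uminus ` d \<notin> T" using inv[of "uminus ` d"] d by auto
  moreover have "uminus ` c \<in> T" using inv c by blast
  ultimately have "T = (T' - cs_pair d) \<union> cs_pair c" "d \<in> T'" "c \<notin> T'"
    using c d unfolding T' cs_pair_def by auto
  with pt show ?thesis unfolding flip_def by blast
qed

lemma wf_flip_graph: "wf_digraph (with_proj (flip_graph n r))"
  by unfold_locales (auto simp: flip_graph_def flip_def)

lemma symmetric_flip_graph: "symmetric (with_proj (flip_graph n r))"
  by (auto simp: symmetric_def flip_graph_def sym_def intro: flip_sym)

lemma loopfree_flip_graph: "\<not> flip n r T T"
  by (auto simp: flip_def cs_pair_def)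

lemma graph_distance_flip_graph:
  "graph_distance (with_proj (flip_graph n r)) T T' =
     (INF p\<in>{p. pre_digraph.awalk (with_proj (flip_graph n r)) T p T'}. ereal (real (length p)))"
proof -
  interpret wf_digraph "with_proj (flip_graph n r)" by (rule wf_flip_graph)
  have "awalk_cost (\<lambda>_. 1) p = real (length p)" for p :: "(complex set set \<times> complex set set) list"
    by (induct p) (auto simp: awalk_cost_def)
  then show ?thesis by (simp add: graph_distance_def \<mu>_def)
qed

lemma zero_notin_segment:
  fixes a b :: complex
  assumes "norm a = 1" "norm b = 1" "b \<noteq> - a"
  shows "0 \<notin> closed_segment a b"
proof
  assume "0 \<in> closed_segment a b"
  then obtain u where u: "0 \<le> u" "u \<le> 1" "(1 - u) *\<^sub>R a + u *\<^sub>R b = 0"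
    by (auto simp: in_segment)
  then have eq: "(1 - u) *\<^sub>R a = - (u *\<^sub>R b)" by (simp add: eq_neg_iff_add_eq_0)
  then have "norm ((1 - u) *\<^sub>R a) = norm (u *\<^sub>R b)" by simp
  then have "u = 1/2" using u assms by simp
  with eq have "a = - b" by (simp add: scaleR_right.minus[symmetric] del: scaleR_minus_right)
  with assms show False by simp
qed

lemma ex_admissible_radius:
  assumes "n \<ge> 2" shows "\<exists>r. admissible_radius n r"
proof -
  define I where "I = {(i, j). i < j \<and> j < 2 * n \<and> j - i \<noteq> n}"
  define S where "S = (\<Union>(i, j)\<in>I. closed_segment (vertex n i) (vertex n j))"
  have "finite I"
    by (rule finite_subset[of _ "{..<2*n} \<times> {..<2*n}"]) (auto simp: I_def)
  then have "closed S" unfolding S_def by (intro closed_UN) auto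
  moreover have "0 \<notin> S"
  proof
    assume "0 \<in> S"
    then obtain i j where ij: "i < j" "j < 2 * n" "j - i \<noteq> n"
      "0 \<in> closed_segment (vertex n i) (vertex n j)"
      unfolding S_def I_def by auto
    then have "vertex n j = - vertex n i"
      using zero_notin_segment[of "vertex n i" "vertex n j"] by (auto simp: vertex_def)
    then have "cis (pi * real j / real n) / cis (pi * real i / real n) = -1"
      by (simp add: vertex_def)
    then have "cis (pi * real (j - i) / real n) = -1"
      using ij assms by (simp add: cis_divide of_nat_diff diff_divide_distrib right_diff_distrib)
    then have *: "cos (pi * real (j - i) / real n) = -1"
      by (metis cis.sel(1) one_complex.sel(1) uminus_complex.sel(1))
    then obtain m :: int where "pi * real (j - i) / real n = (2 * of_int m + 1) * pi"
      unfolding cos_eq_minus1 by (auto simp: algebra_simps)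
    then have "pi * real (j - i) = pi * (of_int (2 * m + 1) * real n)"
      using assms by (simp add: field_simps)
    then have "real (j - i) = of_int (2 * m + 1) * real n"
      using mult_left_cancel[OF pi_neq_zero] by blast
    then have "real_of_int (int (j - i)) = real_of_int ((2 * m + 1) * int n)"
      by simp
    then have m: "int (j - i) = (2 * m + 1) * int n"
      by (simp only: of_int_eq_iff)
    have pos: "0 < (2 * m + 1) * int n" and less: "(2 * m + 1) * int n < 2 * int n"
      unfolding m[symmetric] using ij by auto
    have "0 < 2 * m + 1" using pos by (rule zero_less_mult_pos2) (use assms in simp)
    moreover have "2 * m + 1 < 2" using less by (rule mult_right_less_imp_less) simp
    ultimately have "m = 0" by presburger
    with m ij show False by simp
  qed
  ultimately have "open (- S)" "0 \<in> - S" by auto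
  then obtain e where e: "e > 0" "cball 0 e \<subseteq> - S"
    using open_contains_cball by blast
  have "closed_segment (vertex n i) (vertex n j) \<inter> cball 0 e = {}"
    if "i < j" "j < 2 * n" "j - i \<noteq> n" for i j
  proof -
    have "closed_segment (vertex n i) (vertex n j) \<subseteq> S"
      unfolding S_def I_def using that by blast
    with e(2) show ?thesis by blast
  qed
  with e(1) have "admissible_radius n e"
    unfolding admissible_radius_def by blast
  then show ?thesis by blast
qed

end

theory Submission
  imports Defs
begin

text \<open>
  A crossing-free set contains central chords of both sides only if they all lie at one symmetric
  pair of vertices. Let \<open>l\<close> and \<open>r\<close> be the numbers of symmetric pairs of central chords tangent on
  one side and on the other. A flip changes each by at most one, and a path from the
  pseudotriangulation with \<open>l = n\<close> to the one with \<open>r = n\<close> has to pass through \<open>l \<le> 1\<close>, \<open>r \<le> 1\<close>;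
  hence it has at least \<open>2n - 2\<close> flips.

  Conversely, \<open>l\<close> can be raised by one with a single flip whenever \<open>0 < l < n\<close>. If both ends of the
  path have \<open>l > 0\<close>, or both have \<open>r > 0\<close>, going through the corresponding extreme
  pseudotriangulation takes at most \<open>2(n - 1)\<close> flips. In the remaining case one end has only
  \<open>l > 0\<close> and the other only \<open>r > 0\<close>, say with \<open>l \<le> r\<close>: lowering \<open>l\<close> reaches \<open>r = 1\<close> after \<open>l - 1\<close>
  flips, then \<open>n - 1\<close> flips reach \<open>r = n\<close>, and \<open>n - r\<close> further ones reach the other end.
\<close>

text \<open>Every crossing is decided by cyclic order. The disk lies strictly on one side of the
  line through a diagonal, so the diagonal meets a central chord exactly when the vertex of that
  chord lies strictly inside its short arc. Distinct central chords on the same side are rotations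
  of one another about the centre and never meet. For vertices neither equal nor opposite, some
  representatives of two symmetric pairs on opposite sides do meet.

  A gap of length at least two between consecutive central chords on one side is closed by a
  diagonal or, if only one pair of vertices carries central chords, contains half of the polygon. It
  has a corner q inside; trading the closing diagonal, respectively the chord on the other side, for
  the central chord at q raises the count. Lowering is the same trade backwards. From two pairs to
  one the expected diagonal would be long and is not a chord, so a central chord on the other side
  appears instead. On the way from one extreme to the other, two flips can thus change both counts
  at once (l from 2 to 1, and r from 1 to 2), which is where the 2 subtracted from 2n comes
  from.\<close>

section \<open>Symmetric pairs of chords as integers\<close>

text \<open>
  Vertices are indexed by all integers, the polygon being the quotient modulo \<open>2n\<close>; translation by
  \<open>n\<close> is the central symmetry, so that a symmetric pair of chords is an orbit of translations by
  multiples of \<open>n\<close>. \<open>Cen s k\<close> is the central chord at \<open>k\<close> on the side \<open>s\<close>; \<open>Dia i j\<close> is the diagonal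
  whose short arc goes counterclockwise from \<open>i\<close> to \<open>j\<close>.
\<close>

datatype chord_index = Cen bool int | Dia int int

locale cyclic_size =
  fixes n :: int
  assumes n_ge: "n \<ge> 2"
begin

fun valid :: "chord_index \<Rightarrow> bool" where
  "valid (Cen s k) \<longleftrightarrow> True"
| "valid (Dia i j) \<longleftrightarrow> 2 \<le> j - i \<and> j - i < n"

fun shift :: "int \<Rightarrow> chord_index \<Rightarrow> chord_index" where
  "shift m (Cen s k) = Cen s (k + m * n)"
| "shift m (Dia i j) = Dia (i + m * n) (j + m * n)"

definition shift_closed :: "chord_index set \<Rightarrow> bool" where
  "shift_closed A \<longleftrightarrow> (\<forall>c\<in>A. \<forall>m. shift m c \<in> A)"

definition orbit :: "chord_index \<Rightarrow> chord_index set" where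
  "orbit c = range (\<lambda>m. shift m c)"

text \<open>
  Only meaningful for \<open>A\<close> closed under translation, where every crossing of symmetric pairs is
  visible as a crossing of suitable representatives in the integers.
\<close>

fun compatible :: "chord_index set \<Rightarrow> chord_index \<Rightarrow> bool" where
  "compatible A (Cen s k) \<longleftrightarrow>
     (\<forall>u v. Dia u v \<in> A \<longrightarrow> \<not> (u < k \<and> k < v)) \<and> (\<forall>k'. Cen (\<not> s) k' \<in> A \<longrightarrow> n dvd k - k')"
| "compatible A (Dia i j) \<longleftrightarrow>
     (\<forall>s k. Cen s k \<in> A \<longrightarrow> \<not> (i < k \<and> k < j)) \<and>
     (\<forall>u v. Dia u v \<in> A \<longrightarrow> \<not> (i < u \<and> u < j \<and> j < v) \<and> \<not> (u < i \<and> i < v \<and> v < j))"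

text \<open>Maximality is tested on single chords, not on whole orbits. This matches the geometric
  definition, whose competitors are arbitrary crossing-free sets, and by
  \<open>compatible_self\<close> a valid chord never conflicts with its own translates.\<close>

definition cluster :: "chord_index set \<Rightarrow> bool" where
  "cluster K \<longleftrightarrow> (\<forall>c\<in>K. valid c) \<and> shift_closed K \<and> (\<forall>c\<in>K. compatible K c) \<and>
     (\<forall>c. valid c \<longrightarrow> compatible K c \<longrightarrow> c \<in> K)"

definition exchange :: "chord_index set \<Rightarrow> chord_index set \<Rightarrow> bool" where
  "exchange K K' \<longleftrightarrow> cluster K \<and> cluster K' \<and> (\<exists>c\<in>K. \<exists>d. valid d \<and> d \<notin> K \<and> K' = K - orbit c \<union> orbit d)"

section \<open>Translations, orbits and compatibility\<close>

lemma shift_0 [simp]: "shift 0 c = c"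
  by (cases c) auto

lemma shift_shift [simp]: "shift a (shift b c) = shift (a + b) c"
  by (cases c) (auto simp: algebra_simps)

lemma valid_shift [simp]: "valid (shift m c) = valid c"
  by (cases c) auto

lemma shift_in_iff: "shift_closed A \<Longrightarrow> shift m c \<in> A \<longleftrightarrow> c \<in> A"
proof
  assume "shift_closed A" "shift m c \<in> A"
  then have "shift (- m) (shift m c) \<in> A" unfolding shift_closed_def by blast
  then show "c \<in> A" by simp
qed (auto simp: shift_closed_def)

lemma self_in_orbit [simp]: "c \<in> orbit c"
  unfolding orbit_def by (rule range_eqI[of _ _ 0]) simp

lemma orbit_shift [simp]: "orbit (shift m c) = orbit c"
proof
  show "orbit (shift m c) \<subseteq> orbit c" unfolding orbit_def by auto
  have "shift k c \<in> orbit (shift m c)" for k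
    unfolding orbit_def by (rule range_eqI[of _ _ "k - m"]) simp
  then show "orbit c \<subseteq> orbit (shift m c)" unfolding orbit_def[of c] by blast
qed

lemma in_orbit_iff: "c \<in> orbit d \<longleftrightarrow> (\<exists>m. c = shift m d)"
  by (auto simp: orbit_def)

lemma orbit_eq: "c \<in> orbit d \<Longrightarrow> orbit c = orbit d"
  unfolding in_orbit_iff by auto

lemma shift_closed_orbit: "shift_closed (orbit c)"
  unfolding shift_closed_def orbit_def by auto

lemma shift_closed_Diff: "shift_closed A \<Longrightarrow> shift_closed B \<Longrightarrow> shift_closed (A - B)"
  using shift_in_iff[of B] by (simp add: shift_closed_def)

lemma shift_closed_Un: "shift_closed A \<Longrightarrow> shift_closed B \<Longrightarrow> shift_closed (A \<union> B)"
  by (auto simp: shift_closed_def)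

lemma Cen_orbit_iff: "Cen s k \<in> orbit (Cen s' k') \<longleftrightarrow> s = s' \<and> n dvd k - k'"
proof -
  have "(\<exists>m. k = k' + m * n) \<longleftrightarrow> n dvd k - k'"
    by (auto simp: dvd_def algebra_simps)
  then show ?thesis by (auto simp: in_orbit_iff)
qed

lemma Dia_orbit_iff: "Dia i j \<in> orbit (Dia u v) \<longleftrightarrow> (\<exists>m. i = u + m * n \<and> j = v + m * n)"
  by (auto simp: in_orbit_iff)

lemma mixed_orbit [simp]: "Cen s k \<notin> orbit (Dia u v)" "Dia u v \<notin> orbit (Cen s k)"
  by (auto simp: in_orbit_iff)

lemma compatible_Un: "compatible (A \<union> B) c \<longleftrightarrow> compatible A c \<and> compatible B c"
  by (cases c) auto

lemma Cen_periodic: "shift_closed A \<Longrightarrow> Cen s (k + m * n) \<in> A \<longleftrightarrow> Cen s k \<in> A"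
  using shift_in_iff[of A m "Cen s k"] by simp

lemma Cen_cong:
  assumes "shift_closed A" "n dvd k - k'" shows "Cen s k \<in> A \<longleftrightarrow> Cen s k' \<in> A"
proof -
  obtain m where "k = k' + m * n" using assms(2) by (metis dvd_def mult.commute diff_eq_eq add.commute)
  then show ?thesis using Cen_periodic[OF assms(1)] by simp
qed

lemma Dia_periodic: "shift_closed A \<Longrightarrow> Dia (i + m * n) (j + m * n) \<in> A \<longleftrightarrow> Dia i j \<in> A"
  using shift_in_iff[of A m "Dia i j"] by simp

lemma compatible_shift:
  assumes A: "shift_closed A" and c: "compatible A c" shows "compatible A (shift m c)"
proof -
  have D: "Dia (u - m * n) (v - m * n) \<in> A" if "Dia u v \<in> A" for u v
    using that Dia_periodic[OF A, of u "- m" v] by simp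
  have C: "Cen s (k - m * n) \<in> A" if "Cen s k \<in> A" for s k
    using that Cen_periodic[OF A, of s k "- m"] by simp
  show ?thesis
  proof (cases c)
    case (Cen s k)
    have "\<not> (u < k + m * n \<and> k + m * n < v)" if "Dia u v \<in> A" for u v
      using c D[OF that] unfolding Cen compatible.simps by (metis diff_less_eq less_diff_eq)
    moreover have "n dvd k + m * n - k'" if "Cen (\<not> s) k' \<in> A" for k'
      using c C[OF that] unfolding Cen compatible.simps by (metis diff_diff_eq2)
    ultimately show ?thesis using Cen by simp
  next
    case (Dia i j)
    have "\<not> (i + m * n < k \<and> k < j + m * n)" if "Cen s k \<in> A" for s k
      using c C[OF that] unfolding Dia compatible.simps by (metis diff_less_eq less_diff_eq)
    moreover have "\<not> (i + m * n < u \<and> u < j + m * n \<and> j + m * n < v) \<and>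
        \<not> (u < i + m * n \<and> i + m * n < v \<and> v < j + m * n)" if "Dia u v \<in> A" for u v
      using c D[OF that] unfolding Dia compatible.simps by (metis diff_less_eq less_diff_eq)
    ultimately show ?thesis using Dia by simp
  qed
qed

lemma compatible_orbit:
  "compatible (orbit (Cen s k)) (Cen s' k') \<longleftrightarrow> (s \<noteq> s' \<longrightarrow> n dvd k' - k)"
  "compatible (orbit (Cen s k)) (Dia i j) \<longleftrightarrow> (\<forall>m. \<not> (i < k + m * n \<and> k + m * n < j))"
  "compatible (orbit (Dia i j)) (Cen s k) \<longleftrightarrow> (\<forall>m. \<not> (i + m * n < k \<and> k < j + m * n))"
  "compatible (orbit (Dia i j)) (Dia u v) \<longleftrightarrow>
     (\<forall>m. \<not> (u < i + m * n \<and> i + m * n < v \<and> v < j + m * n) \<and>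
          \<not> (i + m * n < u \<and> u < j + m * n \<and> j + m * n < v))"
proof -
  have "(\<forall>k''. Cen (\<not> s') k'' \<in> orbit (Cen s k) \<longrightarrow> n dvd k' - k'') \<longleftrightarrow> (s \<noteq> s' \<longrightarrow> n dvd k' - k)"
  proof -
    have "n dvd k' - k''" if "n dvd k' - k" "n dvd k'' - k" for k''
      using dvd_diff[OF that] by simp
    moreover have "Cen (\<not> s') k \<in> orbit (Cen s k)" if "s \<noteq> s'"
      using that by (simp add: Cen_orbit_iff)
    ultimately show ?thesis unfolding Cen_orbit_iff by fastforce
  qed
  then show "compatible (orbit (Cen s k)) (Cen s' k') \<longleftrightarrow> (s \<noteq> s' \<longrightarrow> n dvd k' - k)"
    by simp
qed (auto simp: in_orbit_iff)

lemma compatible_orbit_sym: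
  assumes "compatible (orbit c) d" shows "compatible (orbit d) c"
proof -
  \<comment> \<open>Moving a translation from one chord to the other changes its sign, so the
    quantifier is reindexed by \<open>- m\<close>.\<close>
  have all_minus: "(\<forall>m. P m) \<longleftrightarrow> (\<forall>m. P (- m))" for P :: "int \<Rightarrow> bool"
    using minus_minus by metis
  have less: "a < b + - m * n \<longleftrightarrow> a + m * n < b" "a + - m * n < b \<longleftrightarrow> a < b + m * n" for a b m
    by auto
  have 1: "compatible (orbit (Cen s k)) (Dia i j) \<longleftrightarrow> compatible (orbit (Dia i j)) (Cen s k)" for s k i j
    unfolding compatible_orbit
    by (subst all_minus) (simp only: less)
  have 2: "compatible (orbit (Dia i j)) (Dia u v) \<longrightarrow> compatible (orbit (Dia u v)) (Dia i j)" for i j u v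
    unfolding compatible_orbit
    by (subst all_minus) (simp only: less, blast)
  have 3: "compatible (orbit (Cen s k)) (Cen s' k') \<longrightarrow> compatible (orbit (Cen s' k')) (Cen s k)" for s k s' k'
    unfolding compatible_orbit dvd_diff_commute[of n k' k]
    by (intro impI, drule mp, erule not_sym, assumption)
  show ?thesis using assms
    by (cases c; cases d; simp only:; fast intro: 1[THEN iffD1] 1[THEN iffD2] 2[THEN mp] 3[THEN mp])
qed

lemma compatible_mono: "compatible A c \<Longrightarrow> B \<subseteq> A \<Longrightarrow> compatible B c"
  by (metis compatible_Un sup.absorb_iff2)

text \<open>Reduces compatibility with a set to a relation between orbits, the form in which
  symmetry and the comparison with geometric crossings are available.\<close>

lemma compatible_orbit_iff: 
  assumes "shift_closed A"
  shows "compatible A c \<longleftrightarrow> (\<forall>d\<in>A. compatible (orbit d) c)"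
proof
  assume "compatible A c"
  then show "\<forall>d\<in>A. compatible (orbit d) c"
    using assms by (auto simp: shift_closed_def orbit_def intro!: compatible_mono[of A c])
next
  assume *: "\<forall>d\<in>A. compatible (orbit d) c"
  then show "compatible A c"
  proof (cases c)
    case (Cen s k)
    have "\<not> (u < k \<and> k < v)" if "Dia u v \<in> A" for u v
      using *[rule_format, OF that] Cen self_in_orbit[of "Dia u v"] by (auto simp del: self_in_orbit)
    moreover have "n dvd k - k'" if "Cen (\<not> s) k' \<in> A" for k'
      using *[rule_format, OF that] Cen self_in_orbit[of "Cen (\<not> s) k'"] by (auto simp del: self_in_orbit)
    ultimately show ?thesis using Cen by simp
  next
    case (Dia i j)
    have "\<not> (i < k \<and> k < j)" if "Cen s k \<in> A" for s k
      using *[rule_format, OF that] Dia self_in_orbit[of "Cen s k"] by (auto simp del: self_in_orbit)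
    moreover have "\<not> (i < u \<and> u < j \<and> j < v) \<and> \<not> (u < i \<and> i < v \<and> v < j)" if "Dia u v \<in> A" for u v
      using *[rule_format, OF that] Dia self_in_orbit[of "Dia u v"] by (auto simp del: self_in_orbit)
    ultimately show ?thesis using Dia by simp
  qed
qed

text \<open>A diagonal spans fewer than \<open>n\<close> steps, so translating it by a nonzero
  multiple of \<open>n\<close> moves it too far to interleave with itself.\<close>

lemma compatible_self:
  assumes "valid d" shows "compatible (orbit d) d"
proof (cases d)
  case (Cen s k)
  then show ?thesis by (auto simp: in_orbit_iff)
next
  case (Dia i j)
  have "\<not> (i < i + m * n \<and> i + m * n < j)" "\<not> (i + m * n < i \<and> i < j + m * n)" for m
  proof -
    have *: "j - i < n" using assms Dia by simp
    show "\<not> (i < i + m * n \<and> i + m * n < j)"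
    proof
      assume a: "i < i + m * n \<and> i + m * n < j"
      then have "m \<ge> 1" using n_ge by (smt (verit) mult_nonpos_nonneg)
      then have "m * n \<ge> n" using n_ge by (simp add: mult_le_cancel_right1)
      then show False using a * by linarith
    qed
    show "\<not> (i + m * n < i \<and> i < j + m * n)"
    proof
      assume a: "i + m * n < i \<and> i < j + m * n"
      then have "- m \<ge> 1" using n_ge by (smt (verit) mult_nonneg_nonneg)
      then have "(- m) * n \<ge> n" using n_ge by (smt (verit) mult_le_cancel_right1)
      then show False using a * by linarith
    qed
  qed
  then show ?thesis using Dia by (fastforce simp: in_orbit_iff)
qed

section \<open>Clusters and exchanges\<close>

lemma clusterD:
  assumes "cluster K"
  shows "shift_closed K"
    and "\<And>i j. Dia i j \<in> K \<Longrightarrow> 2 \<le> j - i \<and> j - i < n"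
    and "\<And>s k k'. Cen s k \<in> K \<Longrightarrow> Cen (\<not> s) k' \<in> K \<Longrightarrow> n dvd k - k'"
    and "\<And>s i j k. Dia i j \<in> K \<Longrightarrow> Cen s k \<in> K \<Longrightarrow> \<not> (i < k \<and> k < j)"
    and "\<And>i j u v. Dia i j \<in> K \<Longrightarrow> Dia u v \<in> K \<Longrightarrow> \<not> (i < u \<and> u < j \<and> j < v)"
proof -
  show "shift_closed K" using assms unfolding cluster_def by blast
  have v: "valid c" "compatible K c" if "c \<in> K" for c
    using assms that unfolding cluster_def by blast+
  show "2 \<le> j - i \<and> j - i < n" if "Dia i j \<in> K" for i j using v(1)[OF that] by simp
  show "n dvd k - k'" if "Cen s k \<in> K" "Cen (\<not> s) k' \<in> K" for s k k'
    using v(2)[OF that(1)] that(2) by simp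
  show "\<not> (i < k \<and> k < j)" if "Dia i j \<in> K" "Cen s k \<in> K" for s i j k
    using v(2)[OF that(1)] that(2) by simp
  show "\<not> (i < u \<and> u < j \<and> j < v)" if "Dia i j \<in> K" "Dia u v \<in> K" for i j u v
    using v(2)[OF that(1)] that(2) by simp
qed

lemma cluster_addI:
  assumes "cluster K" "valid c" "compatible K c" shows "c \<in> K"
  using assms unfolding cluster_def by blast

text \<open>Uniqueness of the replacement gives maximality of the new set: a further compatible
  chord must belong to \<open>K\<close>, hence to the removed orbit. Then \<open>d\<close> would be
  compatible with all of \<open>K\<close> and lie in \<open>K\<close> by maximality.\<close>

lemma exchangeI:
  assumes K: "cluster K" and c: "c \<in> K" and d: "valid d" "d \<notin> K"
    and compatible: "compatible (K - orbit c) d"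
    and unique: "\<And>e. valid e \<Longrightarrow> compatible (K - orbit c) e \<Longrightarrow> e \<notin> K \<Longrightarrow> e \<in> orbit d"
  shows "exchange K (K - orbit c \<union> orbit d)"
proof -
  define K0 where "K0 = K - orbit c"
  have scK: "shift_closed K" using clusterD[OF K] by blast
  then have sc: "shift_closed K0" unfolding K0_def
    by (intro shift_closed_Diff shift_closed_orbit)
  have KU: "K = K0 \<union> orbit c"
    unfolding K0_def using scK c by (auto simp: in_orbit_iff shift_closed_def)
  have vd: "\<forall>c\<in>K. valid c" and cp: "\<forall>c\<in>K. compatible K c" using K unfolding cluster_def by auto
  have "\<forall>e\<in>K0 \<union> orbit d. valid e"
    using vd d(1) by (auto simp: K0_def in_orbit_iff)
  moreover have "shift_closed (K0 \<union> orbit d)" by (intro shift_closed_Un sc shift_closed_orbit)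
  moreover have "\<forall>e\<in>K0 \<union> orbit d. compatible (K0 \<union> orbit d) e"
  proof (rule ballI, erule UnE)
    fix e assume e: "e \<in> K0"
    have "compatible K e" using e KU cp by blast
    moreover have "compatible (orbit d) e"
      using compatible e compatible_orbit_sym unfolding K0_def[symmetric] compatible_orbit_iff[OF sc]
      by simp
    ultimately show "compatible (K0 \<union> orbit d) e"
      using compatible_mono[of K e K0] by (simp add: compatible_Un K0_def)
  next
    fix e assume "e \<in> orbit d"
    then obtain m where m: "e = shift m d" by (auto simp: in_orbit_iff)
    show "compatible (K0 \<union> orbit d) e" unfolding m compatible_Un using compatible compatible_self[OF d(1)] sc shift_closed_orbit
      by (simp add: K0_def compatible_shift)
  qed
  moreover have "\<forall>e. valid e \<longrightarrow> compatible (K0 \<union> orbit d) e \<longrightarrow> e \<in> K0 \<union> orbit d"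
  proof (intro allI impI, rule ccontr)
    fix e assume e: "valid e" "compatible (K0 \<union> orbit d) e"
    assume ne: "e \<notin> K0 \<union> orbit d"
    then have "e \<in> K" using unique e by (auto simp: compatible_Un K0_def)
    then have "e \<in> orbit c" using ne by (auto simp: K0_def)
    then have "orbit e = orbit c" by (auto simp: in_orbit_iff)
    moreover have "compatible (orbit e) d" using e compatible_orbit_sym by (auto simp: compatible_Un)
    ultimately have "compatible (K0 \<union> orbit c) d" 
      unfolding compatible_Un using compatible unfolding K0_def by simp
    then have "compatible K d" unfolding KU[symmetric] .
    then show False using cluster_addI[OF K] d by blast
  qed
  ultimately have "cluster (K0 \<union> orbit d)" unfolding cluster_def by (intro conjI)
  then show ?thesis using K c d unfolding exchange_def K0_def by (intro conjI bexI[of _ c] exI[of _ d]) simp_all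
qed

lemma exchange_sym: assumes "exchange K K'" shows "exchange K' K"
proof -
  obtain c d where K: "cluster K" "cluster K'" "c \<in> K" "valid d" "d \<notin> K" "K' = K - orbit c \<union> orbit d"
    using assms unfolding exchange_def by blast
  have "orbit c \<subseteq> K" using K clusterD(1) by (auto simp: in_orbit_iff shift_closed_def)
  moreover have "orbit d \<inter> K = {}"
    using K clusterD(1)[OF K(1)] by (auto simp: in_orbit_iff shift_in_iff)
  moreover have "c \<notin> orbit d" using calculation \<open>c \<in> K\<close> by blast
  moreover have "orbit d \<inter> orbit c = {}" using calculation by blast
  ultimately have "K = K' - orbit d \<union> orbit c" "c \<notin> K'"
    unfolding K(6) by (blast, simp)
  moreover have "d \<in> K'" unfolding K(6) by simp
  moreover have "valid c" using K(1,3) unfolding cluster_def by blast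
  ultimately show ?thesis using K(1,2) unfolding exchange_def by (intro conjI bexI[of _ d] exI[of _ c])
qed

section \<open>Counting central chords\<close>

text \<open>Translation by \<open>n\<close> is the central symmetry, so residues modulo
  \<open>n\<close> count symmetric pairs. The values for \<open>True\<close> and
  \<open>False\<close> are the numbers \<open>l\<close> and \<open>r\<close> of the
  overview.\<close>

definition num_central :: "bool \<Rightarrow> chord_index set \<Rightarrow> nat" where
  "num_central s K = card {k \<in> {0..<n}. Cen s k \<in> K}"

lemma n_pos: "n > 0" using n_ge by simp

lemma finite_residues [simp]: "finite {k \<in> {0..<n}. P k}"
  by (rule finite_subset[of _ "{0..<n}"]) auto

lemma Cen_orbit_residue: "{k \<in> {0..<n}. Cen s k \<in> orbit (Cen s p)} = {p mod n}"
proof -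
  have "n dvd k - p \<longleftrightarrow> k = p mod n" if "0 \<le> k" "k < n" for k
    using that mod_eq_dvd_iff[of k n p] by auto
  then show ?thesis using n_pos by (auto simp: Cen_orbit_iff)
qed

lemma Cen_mod: "shift_closed A \<Longrightarrow> Cen s (k mod n) \<in> A \<longleftrightarrow> Cen s k \<in> A"
  by (rule Cen_cong) (auto simp: mod_eq_dvd_iff[symmetric])

lemma num_central_remove:
  assumes "shift_closed K" "Cen s p \<in> K"
  shows "num_central s K = Suc (num_central s (K - orbit (Cen s p)))"
proof -
  have "{k \<in> {0..<n}. Cen s k \<in> K - orbit (Cen s p)} = {k \<in> {0..<n}. Cen s k \<in> K} - {p mod n}"
    unfolding Cen_orbit_residue[of s p, symmetric] by blast
  moreover have "p mod n \<in> {k \<in> {0..<n}. Cen s k \<in> K}"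
    using assms n_pos by (simp add: Cen_mod)
  ultimately show ?thesis unfolding num_central_def by (simp only: card_Suc_Diff1 finite_residues)
qed

lemma num_central_insert:
  assumes "shift_closed K" "Cen s p \<notin> K"
  shows "num_central s (K \<union> orbit (Cen s p)) = Suc (num_central s K)"
proof -
  have "{k \<in> {0..<n}. Cen s k \<in> K \<union> orbit (Cen s p)} = insert (p mod n) {k \<in> {0..<n}. Cen s k \<in> K}"
    using Cen_orbit_residue[of s p] by blast
  moreover have "p mod n \<notin> {k \<in> {0..<n}. Cen s k \<in> K}"
    using assms n_pos by (simp add: Cen_mod)
  ultimately show ?thesis unfolding num_central_def by (simp only: card_insert_disjoint[OF finite_residues] not_False_eq_True)
qed

lemma num_central_other:
  assumes "\<And>k. c \<noteq> Cen s k"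
  shows "num_central s (K - orbit c) = num_central s K" "num_central s (K \<union> orbit c) = num_central s K"
proof -
  have "Cen s k \<notin> orbit c" for k
    using assms by (cases c) (auto simp: Cen_orbit_iff)
  then show "num_central s (K - orbit c) = num_central s K" "num_central s (K \<union> orbit c) = num_central s K"
    unfolding num_central_def by simp_all
qed

lemma num_central_Diff_bounds:
  assumes "shift_closed K" "c \<in> K"
  shows "num_central s (K - orbit c) \<le> num_central s K \<and> num_central s K \<le> Suc (num_central s (K - orbit c))"
proof (cases "\<exists>k. c = Cen s k")
  case True
  then show ?thesis using num_central_remove[OF assms(1), of s] assms(2) by auto
next
  case False
  then show ?thesis using num_central_other(1)[of c s K] by simp
qed

lemma num_central_Un_bounds:
  assumes "shift_closed K" "d \<notin> K"
  shows "num_central s K \<le> num_central s (K \<union> orbit d) \<and> num_central s (K \<union> orbit d) \<le> Suc (num_central s K)"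
proof (cases "\<exists>k. d = Cen s k")
  case True
  then show ?thesis using num_central_insert[OF assms(1), of s] assms(2) by auto
next
  case False
  then show ?thesis using num_central_other(2)[of d s K] by simp
qed

text \<open>The removal can only decrease the count and the insertion can only increase it, each by
  at most one, so the two changes never add up to two.\<close>

lemma exchange_num_central:
  assumes "exchange K K'" shows "num_central s K' \<le> Suc (num_central s K)" "num_central s K \<le> Suc (num_central s K')"
proof -
  obtain c d where K: "cluster K" "c \<in> K" "d \<notin> K" "K' = K - orbit c \<union> orbit d"
    using assms unfolding exchange_def by blast
  have sc: "shift_closed K" "shift_closed (K - orbit c)"
    using clusterD(1)[OF K(1)] by (auto intro: shift_closed_Diff shift_closed_orbit)
  have "d \<notin> K - orbit c" using K by blast
  then show "num_central s K' \<le> Suc (num_central s K)" "num_central s K \<le> Suc (num_central s K')"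
    using num_central_Diff_bounds[OF sc(1) K(2), of s] num_central_Un_bounds[OF sc(2), of d s] unfolding K(4)
    by linarith+
qed

lemma num_central_pos_iff:
  assumes "shift_closed K" shows "num_central s K > 0 \<longleftrightarrow> (\<exists>k. Cen s k \<in> K)"
proof
  assume "\<exists>k. Cen s k \<in> K"
  then show "num_central s K > 0" using num_central_remove[OF assms] by fastforce
next
  assume "num_central s K > 0"
  then have "{k \<in> {0..<n}. Cen s k \<in> K} \<noteq> {}" unfolding num_central_def by (metis card.empty less_irrefl)
  then show "\<exists>k. Cen s k \<in> K" by blast
qed

lemma num_central_le: "num_central s K \<le> nat n"
proof -
  have "card {k \<in> {0..<n}. Cen s k \<in> K} \<le> card {0..<n}" by (intro card_mono) auto
  then show ?thesis unfolding num_central_def by simp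
qed

section \<open>The two extreme clusters and neighbouring central chords\<close>

definition all_central :: "bool \<Rightarrow> chord_index set" where
  "all_central s = range (Cen s)"

text \<open>Nothing can be added: a diagonal from \<open>i\<close> passes over \<open>i + 1\<close>,
  and a chord of the other side at \<open>k\<close> conflicts with the one at \<open>k - 1\<close>,
  because \<open>n\<close> does not divide 1.\<close>

lemma cluster_all_central: "cluster (all_central s)"
  unfolding cluster_def
proof (intro conjI allI impI ballI)
  show "shift_closed (all_central s)" by (auto simp: shift_closed_def all_central_def)
  show "valid c" "compatible (all_central s) c" if "c \<in> all_central s" for c
    using that by (auto simp: all_central_def)
  fix c assume c: "valid c" "compatible (all_central s) c"
  show "c \<in> all_central s"
  proof (cases c)
    case (Cen s' k)
    have "s' = s"
    proof (rule ccontr)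
      assume "s' \<noteq> s"
      then have "Cen (\<not> s') (k - 1) \<in> all_central s" by (auto simp: all_central_def)
      then have "n dvd k - (k - 1)" using c(2) unfolding Cen compatible.simps by blast
      then have "n dvd 1" by simp
      then show False using n_ge zdvd_imp_le[of n 1] by simp
    qed
    then show ?thesis using Cen by (simp add: all_central_def)
  next
    case (Dia i j)
    have "Cen s (i + 1) \<in> all_central s" by (simp add: all_central_def)
    then have "\<not> (i < i + 1 \<and> i + 1 < j)" using c(2) unfolding Dia compatible.simps by blast
    then show ?thesis using c(1) Dia by auto
  qed
qed

lemma num_central_all_central: "num_central s (all_central s) = nat n"
proof -
  have "{k \<in> {0..<n}. Cen s k \<in> all_central s} = {0..<n}" by (auto simp: all_central_def)
  then show ?thesis by (simp add: num_central_def)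
qed

lemma num_central_all_central_other: "num_central (\<not> s) (all_central s) = 0"
  by (auto simp: num_central_def all_central_def image_iff)

lemma all_central_unique:
  assumes K: "cluster K" and all: "\<And>k. Cen s k \<in> K" shows "K = all_central s"
proof
  show sub: "all_central s \<subseteq> K" using all by (auto simp: all_central_def)
  show "K \<subseteq> all_central s"
  proof
    fix c assume "c \<in> K"
    then have "valid c" "compatible K c" using K unfolding cluster_def by blast+
    then show "c \<in> all_central s"
      using cluster_addI[OF cluster_all_central] compatible_mono sub by blast
  qed
qed

lemma Cen_next:
  assumes "shift_closed K" "Cen s p \<in> K"
  obtains q where "x < q" "q \<le> x + n" "Cen s q \<in> K" "\<And>k. x < k \<Longrightarrow> k < q \<Longrightarrow> Cen s k \<notin> K"
proof -
  define S where "S = {k \<in> {x<..x + n}. Cen s k \<in> K}"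
  \<comment> \<open>The translate of \<open>p\<close> in the window of length \<open>n\<close> after
    \<open>x\<close>; it makes the set of candidates nonempty.\<close>
  define q0 where "q0 = x + n - (x - p) mod n"
  have "n dvd (x - p) - (x - p) mod n" by (rule dvd_minus_mod)
  then have "n dvd q0 - p" 
    using dvd_add_triv_left_iff[of n "x - p - (x - p) mod n"] unfolding q0_def by (simp add: algebra_simps)
  then have "Cen s q0 \<in> K" using Cen_cong[OF assms(1)] assms(2) by blast
  moreover have "x < q0" "q0 \<le> x + n" using n_pos by (simp_all add: q0_def)
  ultimately have "S \<noteq> {}" unfolding S_def by auto
  moreover have "finite S" unfolding S_def by (rule finite_subset[of _ "{x<..x + n}"]) auto
  ultimately have "Min S \<in> S" "\<And>k. k \<in> S \<Longrightarrow> Min S \<le> k" by auto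
  then show ?thesis using that[of "Min S"] unfolding S_def
    by (smt (verit) greaterThanAtMost_iff mem_Collect_eq)
qed

text \<open>Without central chords, consider an end of a longest diagonal. A diagonal passing over
  this vertex would be longer or would cross the longest one, so a central chord fits there, against
  maximality.\<close>

lemma cluster_has_Cen:
  assumes K: "cluster K" obtains s k where "Cen s k \<in> K"
proof (cases "\<exists>s k. Cen s k \<in> K")
  case False
  define L where "L = {j - i |i j. Dia i j \<in> K}"
  have L: "L \<subseteq> {0..n}" using clusterD(2)[OF K] by (force simp: L_def)
  have "\<exists>p. \<forall>u v. Dia u v \<in> K \<longrightarrow> \<not> (u < p \<and> p < v)"
  proof (cases "L = {}")
    case True
    then show ?thesis unfolding L_def by blast
  next
    case False
    have fin: "finite L" using L finite_subset by blast
    then have "Max L \<in> L" using False by simp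
    then obtain p p' where p: "Dia p p' \<in> K" "Max L = p' - p" unfolding L_def by blast
    have "\<not> (u < p \<and> p < v)" if uv: "Dia u v \<in> K" for u v
    proof
      assume a: "u < p \<and> p < v"
      have "v - u \<in> L" using uv L_def by blast
      then have "v - u \<le> p' - p" using Max_ge[OF fin] p(2) by simp
      moreover have "\<not> (u < p \<and> p < v \<and> v < p')" by (rule clusterD(5)[OF K uv p(1)])
      ultimately show False using a by linarith
    qed
    then show ?thesis by blast
  qed
  then obtain p where "\<forall>u v. Dia u v \<in> K \<longrightarrow> \<not> (u < p \<and> p < v)" by blast
  then have "compatible K (Cen True p)" using False by simp
  then have "Cen True p \<in> K" by (intro cluster_addI[OF K]) simp_all
  then show ?thesis by (rule that)
qed (use that in blast)

section \<open>Flips that change the number of central chords\<close>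

text \<open>Sides of the polygon are not chords but bound regions just as diagonals do; this treats
  both alike.\<close>

definition edge :: "chord_index set \<Rightarrow> int \<Rightarrow> int \<Rightarrow> bool" where
  "edge K i j \<longleftrightarrow> j = i + 1 \<or> Dia i j \<in> K"

lemma edge_no_crossing:
  assumes "cluster K" "edge K i j" "Dia u v \<in> K"
  shows "\<not> (i < u \<and> u < j \<and> j < v)" "\<not> (u < i \<and> i < v \<and> v < j)"
  using assms clusterD(5)[OF assms(1)] unfolding edge_def by auto

text \<open>The corner \<open>q\<close> is the farthest neighbour of \<open>p\<close> inside the
  gap. A diagonal obstructing the connection from \<open>q\<close> to \<open>p'\<close> would have
  to start at \<open>p\<close>, avoiding both the central chord at \<open>p\<close> and the edge to
  \<open>q\<close>, and would end beyond \<open>q\<close>, contradicting the choice.\<close>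

lemma apex:
  assumes K: "cluster K" and p: "p + 2 \<le> p'" "p' \<le> p + n" and C: "Cen s p \<in> K" "Cen s p' \<in> K"
    and gap: "\<And>s k. p < k \<Longrightarrow> k < p' \<Longrightarrow> Cen s k \<notin> K"
  obtains q where "p < q" "q < p'" "edge K p q" "edge K q p'"
proof -
  define S where "S = {x \<in> {p<..<p'}. edge K p x}"
  have "finite S" unfolding S_def by (rule finite_subset[of _ "{p<..<p'}"]) auto
  moreover have "p + 1 \<in> S" unfolding S_def edge_def using p by simp
  ultimately have x: "Max S \<in> S" and max: "\<And>y. y \<in> S \<Longrightarrow> y \<le> Max S"
    using Max_in[of S] by (blast, simp)
  define q where "q = Max S"
  have q: "p < q" "q < p'" "edge K p q" using x unfolding q_def S_def by auto
  have "edge K q p'"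
  proof (cases "p' = q + 1")
    case False
    have "compatible K (Dia q p')"
    proof (simp only: compatible.simps, intro conjI allI impI)
      show "\<not> (q < k \<and> k < p')" if "Cen s k \<in> K" for s k using gap[of k s] that q by auto
      fix u v assume uv: "Dia u v \<in> K"
      show "\<not> (q < u \<and> u < p' \<and> p' < v)"
        using clusterD(4)[OF K uv C(2)] by blast
      show "\<not> (u < q \<and> q < v \<and> v < p')"
      proof
        assume a: "u < q \<and> q < v \<and> v < p'"
        have "\<not> (u < p \<and> p < v)" by (rule clusterD(4)[OF K uv C(1)])
        moreover have "\<not> (p < u \<and> u < q \<and> q < v)" by (rule edge_no_crossing(1)[OF K q(3) uv])
        ultimately have "u = p" using a q by linarith
        then have "v \<in> S" using a uv q by (simp add: S_def edge_def)
        then show False using max[of v] a by (simp add: q_def)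
      qed
    qed
    then have "Dia q p' \<in> K" using False p q by (intro cluster_addI[OF K]) auto
    then show ?thesis by (simp add: edge_def)
  qed (simp add: edge_def)
  then show ?thesis using that q by blast
qed

text \<open>Any diagonal crossing the one from \<open>p\<close> to \<open>p'\<close> would pass over
  \<open>p\<close> or \<open>p'\<close>, which the central chords there forbid. Maximality then
  supplies it.\<close>

lemma edge_consecutive:
  assumes K: "cluster K" and p: "p < p'" "p' < p + n" and C: "Cen s p \<in> K" "Cen s p' \<in> K"
    and gap: "\<And>s k. p < k \<Longrightarrow> k < p' \<Longrightarrow> Cen s k \<notin> K"
  shows "edge K p p'"
proof (cases "p' = p + 1")
  case False
  have "compatible K (Dia p p')"
  proof (simp only: compatible.simps, intro conjI allI impI)
    show "\<not> (p < k \<and> k < p')" if "Cen s k \<in> K" for s k using gap[of k s] that by auto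
    fix u v assume uv: "Dia u v \<in> K"
    show "\<not> (p < u \<and> u < p' \<and> p' < v)" using clusterD(4)[OF K uv C(2)] by blast
    show "\<not> (u < p \<and> p < v \<and> v < p')" using clusterD(4)[OF K uv C(1)] by blast
  qed
  then have "Dia p p' \<in> K" using False p by (intro cluster_addI[OF K]) auto
  then show ?thesis by (simp add: edge_def)
qed (simp add: edge_def)

lemma no_small_multiple: "0 < x \<Longrightarrow> x < n \<Longrightarrow> \<not> n dvd x"
  using zdvd_imp_le[of n x] by linarith

lemma translate_between:
  assumes "Cen s p \<in> K" "shift_closed K"
  obtains m where "p \<le> k + m * n" "k + m * n < p + n"
proof -
  have "k + (- ((k - p) div n)) * n = p + (k - p) mod n"
    using div_mult_mod_eq[of "k - p" n] by (simp add: algebra_simps)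
  then show ?thesis using that[of "- ((k - p) div n)"] n_pos by simp
qed

text \<open>Whatever newly fits after a removal must conflict with the removed orbit. In the
  exchange lemmas this confines the candidates for replacement to a small region.\<close>

lemma blocked_by_removed:
  assumes K: "cluster K" and c: "c \<in> K"
    and e: "valid e" "compatible (K - orbit c) e" "e \<notin> K"
  shows "\<not> compatible (orbit c) e"
proof
  assume "compatible (orbit c) e"
  then have "compatible (K - orbit c \<union> orbit c) e" using e(2) compatible_Un by blast
  then have "compatible K e" by (rule compatible_mono) blast
  then show False using cluster_addI[OF K e(1)] e(3) by blast
qed

text \<open>Removing the diagonal joins the triangle \<open>p\<close>, \<open>q\<close>,
  \<open>p'\<close> to the region between the diagonal, the two central chords and the disk. The
  edges at \<open>q\<close> and the central chords at \<open>p\<close> and \<open>p'\<close> leave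
  only one other way to split the union: the tangent from \<open>q\<close> on side
  \<open>s\<close>.\<close>

lemma raise_at_diagonal:
  assumes K: "cluster K" and D: "Dia p p' \<in> K" and C: "Cen s p \<in> K" "Cen s p' \<in> K"
    and only: "\<And>k. Cen (\<not> s) k \<notin> K" and gap: "\<And>k. p < k \<Longrightarrow> k < p' \<Longrightarrow> Cen s k \<notin> K"
    and q: "p < q" "q < p'" "edge K p q" "edge K q p'"
  shows "exchange K (K - orbit (Dia p p') \<union> orbit (Cen s q))"
proof (rule exchangeI[OF K D])
  let ?K0 = "K - orbit (Dia p p')"
  have len: "2 \<le> p' - p" "p' - p < n" using clusterD(2)[OF K D] by auto
  have sc: "shift_closed K" by (rule clusterD(1)[OF K])
  have Cmem: "Cen t k \<in> ?K0 \<longleftrightarrow> Cen t k \<in> K" for t k by simp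
  have edge0: "edge ?K0 i j" if "edge K i j" "j - i < p' - p" for i j
    using that by (auto simp: edge_def Dia_orbit_iff)
  have e1: "edge ?K0 p q" and e2: "edge ?K0 q p'" using q by (auto intro: edge0)
  show "valid (Cen s q)" by simp
  show "Cen s q \<notin> K" using gap q by blast
  show "compatible ?K0 (Cen s q)"
  proof (simp only: compatible.simps, intro conjI allI impI)
    fix u v assume uv: "Dia u v \<in> ?K0"
    then have uvK: "Dia u v \<in> K" by simp
    show "\<not> (u < q \<and> q < v)"
    proof
      assume a: "u < q \<and> q < v"
      have "u = p"
        using clusterD(4)[OF K uvK C(1)] edge_no_crossing(1)[OF K q(3) uvK] a q by linarith
      moreover have "v = p'"
        using clusterD(4)[OF K uvK C(2)] edge_no_crossing(2)[OF K q(4) uvK] a q by linarith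
      ultimately show False using uv by simp
    qed
  qed (use only in simp)
  fix e assume e: "valid e" "compatible ?K0 e" "e \<notin> K"
  have ncomp: "\<not> compatible (orbit (Dia p p')) e"
    by (rule blocked_by_removed[OF K D e])
  have sc0: "shift_closed ?K0" by (intro shift_closed_Diff sc shift_closed_orbit)
  show "e \<in> orbit (Cen s q)"
  proof (cases e)
    case (Cen t k)
    obtain m where m: "p + m * n < k" "k < p' + m * n"
      using ncomp unfolding Cen compatible_orbit by blast
    define k' where "k' = k - m * n"
    have k': "p < k'" "k' < p'" using m unfolding k'_def by auto
    have comp: "compatible ?K0 (Cen t k')"
      using compatible_shift[OF sc0 e(2), of "- m"] unfolding Cen k'_def by simp
    have "\<not> (p < k' \<and> k' < q)" "\<not> (q < k' \<and> k' < p')"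
      using comp e1 e2 unfolding edge_def compatible.simps by (force, force)
    then have "k' = q" using k' by linarith
    moreover have "t = s"
    proof (rule ccontr)
      assume "t \<noteq> s"
      then have "Cen (\<not> t) p \<in> ?K0" using C by simp
      then have "n dvd k' - p" using comp by simp
      then show False using no_small_multiple[of "k' - p"] k' len by linarith
    qed
    ultimately show ?thesis unfolding Cen Cen_orbit_iff k'_def by auto
  next
    case (Dia u v)
    \<comment> \<open>Diagonals that interleave with a translate of the removed one pass over one of
      its ends, where a central chord remains.\<close>
    obtain m where m: "u < p + m * n \<and> p + m * n < v \<or> u < p' + m * n \<and> p' + m * n < v"
      using ncomp unfolding Dia compatible_orbit by blast
    have "Cen s (p + m * n) \<in> ?K0" "Cen s (p' + m * n) \<in> ?K0"
      using C by (simp_all add: Cen_periodic[OF sc])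
    then show ?thesis using e(2) m unfolding Dia compatible.simps by blast
  qed
qed

text \<open>All central chords sit at the translates of \<open>p\<close>, so the gap is the half
  polygon from \<open>p\<close> to \<open>p + n\<close>. No diagonal closes it, since that one would
  be long; the chord on the other side is given up instead.\<close>

lemma raise_at_mixed:
  assumes K: "cluster K" and C: "Cen s p \<in> K" "Cen (\<not> s) p \<in> K"
    and q: "p < q" "q < p + n" "edge K p q" "edge K q (p + n)"
  shows "exchange K (K - orbit (Cen (\<not> s) p) \<union> orbit (Cen s q))"
proof (rule exchangeI[OF K C(2)])
  let ?K0 = "K - orbit (Cen (\<not> s) p)"
  have sc: "shift_closed K" by (rule clusterD(1)[OF K])
  have sc0: "shift_closed ?K0" by (intro shift_closed_Diff sc shift_closed_orbit)
  have C': "Cen s (p + n) \<in> K" using Cen_periodic[OF sc, of s p 1] C by simp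
  have cong: "n dvd k - p" if "Cen t k \<in> K" for t k
    using clusterD(3)[OF K, of t k p] C that by (cases "t = s") auto
  show "valid (Cen s q)" by simp
  show "Cen s q \<notin> K" using cong no_small_multiple[of "q - p"] q by auto
  show "compatible ?K0 (Cen s q)"
  proof (simp only: compatible.simps, intro conjI allI impI)
    fix u v assume uv: "Dia u v \<in> ?K0"
    then have uvK: "Dia u v \<in> K" by simp
    show "\<not> (u < q \<and> q < v)"
    proof
      assume a: "u < q \<and> q < v"
      have "u = p"
        using clusterD(4)[OF K uvK C(1)] edge_no_crossing(1)[OF K q(3) uvK] a q by linarith
      moreover have "v = p + n"
        using clusterD(4)[OF K uvK C'] edge_no_crossing(2)[OF K q(4) uvK] a q by linarith
      ultimately show False using clusterD(2)[OF K uvK] by simp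
    qed
  next
    fix k assume "Cen (\<not> s) k \<in> ?K0"
    then show "n dvd q - k" using cong by (auto simp: Cen_orbit_iff)
  qed
  fix e assume e: "valid e" "compatible ?K0 e" "e \<notin> K"
  have ncomp: "\<not> compatible (orbit (Cen (\<not> s) p)) e"
    by (rule blocked_by_removed[OF K C(2) e])
  show "e \<in> orbit (Cen s q)"
  proof (cases e)
    case (Cen t k)
    have t: "t = s" "\<not> n dvd k - p" using ncomp unfolding Cen compatible_orbit by auto
    obtain m where m: "p \<le> k + m * n" "k + m * n < p + n"
      using translate_between[OF C(1) sc] by blast
    define k' where "k' = k + m * n"
    have comp: "compatible ?K0 (Cen t k')"
      using compatible_shift[OF sc0 e(2), of m] unfolding Cen k'_def by simp
    have "k' \<noteq> p"
    proof
      assume "k' = p"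
      then have "k - p = n * (- m)" unfolding k'_def by (simp add: algebra_simps)
      then show False using t by simp
    qed
    moreover have "edge ?K0 p q" "edge ?K0 q (p + n)" using q by (auto simp: edge_def)
    then have "\<not> (p < k' \<and> k' < q)" "\<not> (q < k' \<and> k' < p + n)"
      using comp unfolding edge_def compatible.simps by (force, force)
    ultimately have "k' = q" using m unfolding k'_def by linarith
    then show ?thesis unfolding Cen Cen_orbit_iff k'_def t using t(1) by auto
  next
    case (Dia u v)
    obtain m where m: "u < p + m * n \<and> p + m * n < v"
      using ncomp unfolding Dia compatible_orbit by blast
    have "Cen s (p + m * n) \<in> ?K0"
      using C by (simp add: Cen_periodic[OF sc] Cen_orbit_iff)
    then show ?thesis using e(2) m unfolding Dia compatible.simps by blast
  qed
qed

text \<open>The chord already at \<open>p\<close> shows that no diagonal passes over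
  \<open>p\<close>, and two sides may coexist at a single symmetric pair; maximality adds the second
  one.\<close>

lemma opposite_if_single:
  assumes K: "cluster K" and C: "Cen s p \<in> K" and single: "\<And>k. Cen s k \<in> K \<Longrightarrow> n dvd k - p"
  shows "Cen (\<not> s) p \<in> K"
proof (rule cluster_addI[OF K])
  show "compatible K (Cen (\<not> s) p)"
    using clusterD(4)[OF K _ C] single by (auto simp: dvd_diff_commute)
qed simp

lemma opposite_if_gap:
  assumes K: "cluster K" and C: "Cen s p \<in> K"
    and gap: "\<And>k. p < k \<Longrightarrow> k < p + n \<Longrightarrow> Cen s k \<notin> K"
  shows "Cen (\<not> s) p \<in> K"
proof (rule opposite_if_single[OF K C])
  have sc: "shift_closed K" by (rule clusterD(1)[OF K])
  fix k assume k: "Cen s k \<in> K"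
  obtain m where m: "p \<le> k + m * n" "k + m * n < p + n"
    using translate_between[OF C sc] by blast
  have "Cen s (k + m * n) \<in> K" using Cen_periodic[OF sc] k by blast
  then have "k + m * n = p" using gap[of "k + m * n"] m by force
  then have "k - p = n * (- m)" by (simp add: algebra_simps)
  then show "n dvd k - p" by simp
qed

text \<open>Some central chord is followed by a vertex without one, and the gap after it has a
  corner by \<open>apex\<close>. If the other side occurs, the gap has length \<open>n\<close> and
  the mixed exchange applies. Otherwise it is shorter, since a lone pair would be joined by its
  opposite, and a diagonal closes it.\<close>

lemma exchange_raise:
  assumes K: "cluster K" and C: "Cen s p0 \<in> K" and missing: "Cen s k0 \<notin> K"
  obtains K' where "exchange K K'" "num_central s K' = Suc (num_central s K)"
proof -
  have sc: "shift_closed K" by (rule clusterD(1)[OF K])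
  have "\<exists>p. Cen s p \<in> K \<and> Cen s (p + 1) \<notin> K"
  proof (rule ccontr)
    assume *: "\<not> ?thesis"
    \<comment> \<open>If every chord on side \<open>s\<close> had a successor at the next vertex,
      going upwards from \<open>p0\<close> would reach a translate of the missing
      \<open>k0\<close>.\<close>
    obtain m where m: "p0 \<le> k0 + m * n" using translate_between[OF C sc] by blast
    then have "Cen s (k0 + m * n) \<in> K"
      by (induction rule: int_ge_induct) (use C * in auto)
    then show False using missing Cen_periodic[OF sc] by blast
  qed
  then obtain p where p: "Cen s p \<in> K" "Cen s (p + 1) \<notin> K" by blast
  obtain p' where p': "p < p'" "p' \<le> p + n" "Cen s p' \<in> K" "\<And>k. p < k \<Longrightarrow> k < p' \<Longrightarrow> Cen s k \<notin> K"
    using Cen_next[OF sc C, of p] by metis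
  have two: "p + 2 \<le> p'" using p p'
    by (cases "p' = p + 1") auto
  show ?thesis
  proof (cases "\<exists>k. Cen (\<not> s) k \<in> K")
    case True
    then obtain k where k: "Cen (\<not> s) k \<in> K" by blast
    have "n dvd p - k" using clusterD(3)[OF K p(1) k] .
    then have C2: "Cen (\<not> s) p \<in> K" using Cen_cong[OF sc] k by blast
    have cong: "n dvd k - p" if "Cen t k \<in> K" for t k
      using clusterD(3)[OF K, of t k p] p C2 that by (cases "t = s") auto
    have "p' = p + n"
    proof (rule ccontr)
      assume "p' \<noteq> p + n"
      then show False using cong[OF p'(3)] no_small_multiple[of "p' - p"] p' by linarith
    qed
    have gap: "Cen t k \<notin> K" if "p < k" "k < p'" for t k
      using cong[of t k] no_small_multiple[of "k - p"] that p'(2) by auto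
    obtain q where q: "p < q" "q < p'" "edge K p q" "edge K q p'"
      using apex[OF K two p'(2) p(1) p'(3) gap] by blast
    note ex = raise_at_mixed[OF K p(1) C2 q[unfolded \<open>p' = p + n\<close>]]
    have "num_central s (K - orbit (Cen (\<not> s) p) \<union> orbit (Cen s q)) = Suc (num_central s (K - orbit (Cen (\<not> s) p)))"
      using gap q by (intro num_central_insert shift_closed_Diff sc shift_closed_orbit) auto
    also have "num_central s (K - orbit (Cen (\<not> s) p)) = num_central s K"
      by (rule num_central_other) simp
    finally show ?thesis using that ex by blast
  next
    case False
    have "p' < p + n"
    proof (rule ccontr)
      assume "\<not> p' < p + n"
      then have eq: "p' = p + n" using p' by simp
      then show False using opposite_if_gap[OF K p(1)] p'(4) False by blast
    qed
    have gap: "Cen t k \<notin> K" if "p < k" "k < p'" for t k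
      using p'(4)[OF that] False by (cases "t = s") auto
    obtain q where q: "p < q" "q < p'" "edge K p q" "edge K q p'"
      using apex[OF K two p'(2) p(1) p'(3) gap] by blast
    have "Dia p p' \<in> K"
      using edge_consecutive[OF K p'(1) \<open>p' < p + n\<close> p(1) p'(3) gap] two by (auto simp: edge_def)
    then have ex: "exchange K (K - orbit (Dia p p') \<union> orbit (Cen s q))"
      using raise_at_diagonal[OF K _ p(1) p'(3) _ p'(4) q] False by blast
    have "num_central s (K - orbit (Dia p p') \<union> orbit (Cen s q)) = Suc (num_central s (K - orbit (Dia p p')))"
      using gap q by (intro num_central_insert shift_closed_Diff sc shift_closed_orbit) auto
    also have "num_central s (K - orbit (Dia p p')) = num_central s K"
      by (rule num_central_other) simp
    finally show ?thesis using that ex by blast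
  qed
qed

text \<open>Reverses \<open>raise_at_diagonal\<close> at three consecutive central chords, with the
  middle one as the corner. The bound \<open>p3 < p1 + n\<close> keeps the new diagonal short and
  also excludes central chords on the other side, which would have to be congruent to both
  \<open>p1\<close> and \<open>p3\<close>.\<close>

lemma lower_by_diagonal:
  assumes K: "cluster K" and only: "\<And>k. Cen (\<not> s) k \<notin> K"
    and p: "p1 < p2" "p2 < p3" "p3 < p1 + n"
    and C: "Cen s p1 \<in> K" "Cen s p2 \<in> K" "Cen s p3 \<in> K"
    and gap: "\<And>k. p1 < k \<Longrightarrow> k < p2 \<Longrightarrow> Cen s k \<notin> K" "\<And>k. p2 < k \<Longrightarrow> k < p3 \<Longrightarrow> Cen s k \<notin> K"
  shows "exchange K (K - orbit (Cen s p2) \<union> orbit (Dia p1 p3))"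
proof (rule exchangeI[OF K C(2)])
  let ?K0 = "K - orbit (Cen s p2)"
  have sc: "shift_closed K" by (rule clusterD(1)[OF K])
  have sc0: "shift_closed ?K0" by (intro shift_closed_Diff sc shift_closed_orbit)
  have notall: "Cen t k \<notin> K" if "p1 < k" "k < p2 \<or> p2 < k" "k < p3" for t k
    using only gap that by (cases "t = s") auto
  have e1: "edge K p1 p2" and e2: "edge K p2 p3"
    by (rule edge_consecutive[OF K _ _ C(1,2)] edge_consecutive[OF K _ _ C(2,3)]; use p notall in auto)+
  have C1: "Cen s p1 \<in> ?K0" and C3: "Cen s p3 \<in> ?K0"
    using C p no_small_multiple[of "p2 - p1"] no_small_multiple[of "p3 - p2"]
    by (auto simp: Cen_orbit_iff dvd_diff_commute)
  show "valid (Dia p1 p3)" using p by simp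
  show "Dia p1 p3 \<notin> K" using clusterD(4)[OF K _ C(2)] p by blast
  show "compatible ?K0 (Dia p1 p3)"
  proof (simp only: compatible.simps, intro conjI allI impI)
    show "\<not> (p1 < k \<and> k < p3)" if k: "Cen t k \<in> ?K0" for t k
    proof
      assume a: "p1 < k \<and> k < p3"
      then have "k = p2" using notall[of k t] k by force
      moreover have "t = s" using only[of k] k by (cases "t = s") auto
      ultimately show False using k by simp
    qed
    fix u v assume "Dia u v \<in> ?K0"
    then have uv: "Dia u v \<in> K" by simp
    show "\<not> (p1 < u \<and> u < p3 \<and> p3 < v)" using clusterD(4)[OF K uv C(3)] by blast
    show "\<not> (u < p1 \<and> p1 < v \<and> v < p3)" using clusterD(4)[OF K uv C(1)] by blast
  qed
  fix e assume e: "valid e" "compatible ?K0 e" "e \<notin> K"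
  have ncomp: "\<not> compatible (orbit (Cen s p2)) e"
    by (rule blocked_by_removed[OF K C(2) e])
  show "e \<in> orbit (Dia p1 p3)"
  proof (cases e)
    case (Cen t k)
    have t: "s = (\<not> t)" using ncomp unfolding Cen compatible_orbit by blast
    have "n dvd k - p1" "n dvd k - p3"
      using e(2) C1 C3 unfolding Cen compatible.simps t by blast+
    from dvd_diff[OF this] have "n dvd p3 - p1" by simp
    then show ?thesis using no_small_multiple[of "p3 - p1"] p by simp
  next
    case (Dia u v)
    obtain m where m: "u < p2 + m * n" "p2 + m * n < v"
      using ncomp unfolding Dia compatible_orbit by blast
    define u' v' where "u' = u - m * n" and "v' = v - m * n"
    have uv: "u' < p2" "p2 < v'" using m unfolding u'_def v'_def by auto
    have comp: "compatible ?K0 (Dia u' v')"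
      using compatible_shift[OF sc0 e(2), of "- m"] unfolding Dia u'_def v'_def by simp
    have E: "edge ?K0 p1 p2" "edge ?K0 p2 p3" using e1 e2 by (auto simp: edge_def)
    have "u' = p1"
    proof -
      have "\<not> (u' < p1 \<and> p1 < v')" using comp C1 by simp
      moreover have "\<not> (p1 < u' \<and> u' < p2 \<and> p2 < v')"
        using comp E(1) unfolding edge_def compatible.simps by (force)
      ultimately show ?thesis using uv p by linarith
    qed
    moreover have "v' = p3"
    proof -
      have "\<not> (u' < p3 \<and> p3 < v')" using comp C3 by simp
      moreover have "\<not> (u' < p2 \<and> p2 < v' \<and> v' < p3)"
        using comp E(2) unfolding edge_def compatible.simps by (force)
      ultimately show ?thesis using uv p by linarith
    qed
    ultimately show ?thesis unfolding Dia Dia_orbit_iff u'_def v'_def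
      by (intro exI[of _ m]) auto
  qed
qed

text \<open>With only two pairs left, the diagonal used in \<open>lower_by_diagonal\<close> would
  run from \<open>p1\<close> to \<open>p1 + n\<close>, which is long. The freed region is split by
  the second tangent at \<open>p1\<close> instead.\<close>

lemma lower_to_mixed:
  assumes K: "cluster K" and only: "\<And>k. Cen (\<not> s) k \<notin> K"
    and p: "p1 < p2" "p2 < p1 + n"
    and C: "Cen s p1 \<in> K" "Cen s p2 \<in> K"
    and gap: "\<And>k. p1 < k \<Longrightarrow> k < p2 \<Longrightarrow> Cen s k \<notin> K" "\<And>k. p2 < k \<Longrightarrow> k < p1 + n \<Longrightarrow> Cen s k \<notin> K"
  shows "exchange K (K - orbit (Cen s p2) \<union> orbit (Cen (\<not> s) p1))"
proof (rule exchangeI[OF K C(2)])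
  let ?K0 = "K - orbit (Cen s p2)"
  have sc: "shift_closed K" by (rule clusterD(1)[OF K])
  have sc0: "shift_closed ?K0" by (intro shift_closed_Diff sc shift_closed_orbit)
  have C3: "Cen s (p1 + n) \<in> K" using Cen_periodic[OF sc, of s p1 1] C by simp
  have notall: "Cen t k \<notin> K" if "p1 < k" "k < p2 \<or> p2 < k" "k < p1 + n" for t k
    using only gap that by (cases "t = s") auto
  have e1: "edge K p1 p2" and e2: "edge K p2 (p1 + n)"
    by (rule edge_consecutive[OF K _ _ C] edge_consecutive[OF K _ _ C(2) C3]; use p notall in auto)+
  have C10: "Cen s p1 \<in> ?K0"
    using C p no_small_multiple[of "p2 - p1"] by (auto simp: Cen_orbit_iff dvd_diff_commute)
  then have C30: "Cen s (p1 + n) \<in> ?K0" using Cen_periodic[OF sc0, of s p1 1] by simp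
  show "valid (Cen (\<not> s) p1)" by simp
  show "Cen (\<not> s) p1 \<notin> K" using only .
  show "compatible ?K0 (Cen (\<not> s) p1)"
  proof (simp only: compatible.simps, intro conjI allI impI)
    show "\<not> (u < p1 \<and> p1 < v)" if "Dia u v \<in> ?K0" for u v
      using clusterD(4)[OF K _ C(1)] that by blast
    fix k assume "Cen (\<not> \<not> s) k \<in> ?K0"
    then have k: "Cen s k \<in> K" "\<not> n dvd k - p2" by (auto simp: Cen_orbit_iff)
    obtain m where m: "p1 \<le> k + m * n" "k + m * n < p1 + n"
      using translate_between[OF C(1) sc] by blast
    have "Cen s (k + m * n) \<in> K" using Cen_periodic[OF sc] k by blast
    then have "k + m * n = p1 \<or> k + m * n = p2" using notall[of "k + m * n" s] m by force
    moreover have "k + m * n \<noteq> p2"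
    proof
      assume "k + m * n = p2"
      then have "k - p2 = n * (- m)" by (simp add: algebra_simps)
      then show False using k by simp
    qed
    ultimately have "p1 - k = n * m" by (simp add: algebra_simps)
    then show "n dvd p1 - k" by simp
  qed
  fix e assume e: "valid e" "compatible ?K0 e" "e \<notin> K"
  have ncomp: "\<not> compatible (orbit (Cen s p2)) e"
    by (rule blocked_by_removed[OF K C(2) e])
  show "e \<in> orbit (Cen (\<not> s) p1)"
  proof (cases e)
    case (Cen t k)
    have t: "s = (\<not> t)" using ncomp unfolding Cen compatible_orbit by blast
    have "n dvd k - p1"
      using e(2) C10 unfolding Cen compatible.simps t by blast
    then show ?thesis unfolding Cen Cen_orbit_iff t by simp
  next
    case (Dia u v)
    obtain m where m: "u < p2 + m * n" "p2 + m * n < v"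
      using ncomp unfolding Dia compatible_orbit by blast
    define u' v' where "u' = u - m * n" and "v' = v - m * n"
    have uv: "u' < p2" "p2 < v'" using m unfolding u'_def v'_def by auto
    have comp: "compatible ?K0 (Dia u' v')"
      using compatible_shift[OF sc0 e(2), of "- m"] unfolding Dia u'_def v'_def by simp
    have E: "edge ?K0 p1 p2" "edge ?K0 p2 (p1 + n)" using e1 e2 by (auto simp: edge_def)
    have "u' = p1"
    proof -
      have "\<not> (u' < p1 \<and> p1 < v')" using comp C10 by simp
      moreover have "\<not> (p1 < u' \<and> u' < p2 \<and> p2 < v')"
        using comp E(1) unfolding edge_def compatible.simps by (force)
      ultimately show ?thesis using uv p by linarith
    qed
    moreover have "v' = p1 + n"
    proof -
      have "\<not> (u' < p1 + n \<and> p1 + n < v')" using comp C30 by simp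
      moreover have "\<not> (u' < p2 \<and> p2 < v' \<and> v' < p1 + n)"
        using comp E(2) unfolding edge_def compatible.simps by (force)
      ultimately show ?thesis using uv p by linarith
    qed
    \<comment> \<open>Only the long diagonal is left as a candidate, and it is not
      \<open>valid\<close>.\<close>
    ultimately have "v - u = n" unfolding u'_def v'_def by simp
    then show ?thesis using e(1) Dia by simp
  qed
qed

section \<open>Distances in the combinatorial model\<close>

definition reach :: "nat \<Rightarrow> chord_index set \<Rightarrow> chord_index set \<Rightarrow> bool" where
  "reach k K K' \<longleftrightarrow> (\<exists>j\<le>k. (exchange ^^ j) K K')"

lemma reach_refl: "reach k K K"
  unfolding reach_def by (intro exI[of _ 0]) simp

lemma reach_exchange: "exchange K K' \<Longrightarrow> reach k K' K'' \<Longrightarrow> reach (Suc k) K K''"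
  unfolding reach_def using relpowp_Suc_I2[of exchange K K'] by (metis Suc_le_mono)

lemma reach_trans: "reach a K K' \<Longrightarrow> reach b K' K'' \<Longrightarrow> reach (a + b) K K''"
  unfolding reach_def using relpowp_trans[of _ exchange] by (metis add_mono)

lemma reach_mono: "reach a K K' \<Longrightarrow> a \<le> b \<Longrightarrow> reach b K K'"
  unfolding reach_def by (metis order_trans)

lemma reach_sym:
  assumes "reach k K K'" shows "reach k K' K"
proof -
  have "(exchange ^^ j) K' K" if "(exchange ^^ j) K K'" for j
    using that
  proof (induction j arbitrary: K')
    case (Suc j)
    then obtain L where "(exchange ^^ j) K L" "exchange L K'" by (auto elim: relpowp_Suc_E)
    then show ?case using Suc.IH exchange_sym relpowp_Suc_I2[of exchange] by metis
  qed simp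
  then show ?thesis using assms unfolding reach_def by blast
qed

lemma exchange_cluster: "exchange K K' \<Longrightarrow> cluster K \<and> cluster K'"
  by (auto simp: exchange_def)

lemma reach_all_central:
  assumes "cluster K" "Cen s p \<in> K" shows "reach (nat n - num_central s K) K (all_central s)"
  using assms
proof (induction "nat n - num_central s K" arbitrary: K p)
  case K: 0
  show ?case
  proof (cases "\<exists>k. Cen s k \<notin> K")
    case True
    then obtain K' where "num_central s K' = Suc (num_central s K)"
      using exchange_raise[OF K(2,3)] by blast
    then show ?thesis using K(1) num_central_le[of s K'] by linarith
  next
    case False
    then have "K = all_central s" using all_central_unique[OF K(2)] by blast
    then show ?thesis using reach_refl by simp
  qed
next
  case K: (Suc m)
  show ?case
  proof (cases "\<exists>k. Cen s k \<notin> K")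
    case True
    then obtain K' where K': "exchange K K'" "num_central s K' = Suc (num_central s K)"
      using exchange_raise[OF K(3,4)] by blast
    have cK': "cluster K'" using exchange_cluster[OF K'(1)] by blast
    obtain p' where "Cen s p' \<in> K'"
      using num_central_pos_iff[OF clusterD(1)[OF cK'], of s] K'(2) by auto
    then have "reach (nat n - num_central s K') K' (all_central s)"
      using K(1)[of K'] K(2) K'(2) cK' by simp
    moreover have "nat n - num_central s K = Suc (nat n - num_central s K')" using K(2) K'(2) by simp
    ultimately show ?thesis using reach_exchange[OF K'(1)] by simp
  next
    case False
    then have "K = all_central s" using all_central_unique[OF K(3)] by blast
    then show ?thesis using reach_refl by simp
  qed
qed

text \<open>Diagonals replace central chords one at a time until two pairs are left; the next flip
  creates a chord on the other side. A single pair cannot occur at the start, since its opposite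
  would be present. Hence one flip fewer than the number of pairs.\<close>

lemma reach_mixed:
  assumes "cluster K" "Cen s p \<in> K" "\<And>k. Cen (\<not> s) k \<notin> K"
  shows "\<exists>M q. cluster M \<and> reach (num_central s K - 1) K M \<and> Cen (\<not> s) q \<in> M"
  using assms
proof (induction "num_central s K" arbitrary: K p rule: less_induct)
  case less
  note K = less(2) and C = less(3) and only = less(4)
  have sc: "shift_closed K" by (rule clusterD(1)[OF K])
  obtain p2 where p2: "p < p2" "p2 \<le> p + n" "Cen s p2 \<in> K" "\<And>k. p < k \<Longrightarrow> k < p2 \<Longrightarrow> Cen s k \<notin> K"
    using Cen_next[OF sc C, of p] by metis
  have "p2 \<noteq> p + n"
  proof
    assume eq: "p2 = p + n"
    then show False using opposite_if_gap[OF K C] p2(4) only by blast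
  qed
  then have p2': "p2 < p + n" using p2 by simp
  obtain p3 where p3: "p2 < p3" "p3 \<le> p2 + n" "Cen s p3 \<in> K" "\<And>k. p2 < k \<Longrightarrow> k < p3 \<Longrightarrow> Cen s k \<notin> K"
    using Cen_next[OF sc C, of p2] by metis
  have C': "Cen s (p + n) \<in> K" using Cen_periodic[OF sc, of s p 1] C by simp
  have "p3 \<le> p + n" using p3(4)[of "p + n"] C' p2' by force
  let ?K0 = "K - orbit (Cen s p2)"
  have cnt: "num_central s K = Suc (num_central s ?K0)" by (rule num_central_remove[OF sc p2(3)])
  have sc0: "shift_closed ?K0" by (intro shift_closed_Diff sc shift_closed_orbit)
  have "Cen s p \<in> ?K0"
    using C no_small_multiple[of "p2 - p"] p2 p2' by (auto simp: Cen_orbit_iff dvd_diff_commute)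
  then have pos: "num_central s ?K0 > 0" using num_central_pos_iff[OF sc0] by blast
  show ?case
  proof (cases "p3 = p + n")
    case True
    let ?M = "?K0 \<union> orbit (Cen (\<not> s) p)"
    have ex: "exchange K ?M"
      using lower_to_mixed[OF K only p2(1) p2' C p2(3,4) p3(4)[unfolded True]] by blast
    have "reach (Suc 0) K ?M" by (rule reach_exchange[OF ex reach_refl])
    then have "reach (num_central s K - 1) K ?M" by (rule reach_mono) (use cnt pos in simp)
    moreover have "Cen (\<not> s) p \<in> ?M" by simp
    ultimately show ?thesis using exchange_cluster[OF ex] by blast
  next
    case False
    let ?K' = "?K0 \<union> orbit (Dia p p3)"
    have ex: "exchange K ?K'"
      using lower_by_diagonal[OF K only p2(1) p3(1) _ C p2(3) p3(3) p2(4) p3(4)] False \<open>p3 \<le> p + n\<close>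
      by simp
    have cnt': "num_central s ?K' = num_central s ?K0" by (rule num_central_other) simp
    have "Cen s p \<in> ?K'" using \<open>Cen s p \<in> ?K0\<close> by blast
    moreover have "Cen (\<not> s) k \<notin> ?K'" for k using only by simp
    moreover have "num_central s ?K' < num_central s K" using cnt cnt' by simp
    ultimately obtain M q where M: "cluster M" "reach (num_central s ?K' - 1) ?K' M" "Cen (\<not> s) q \<in> M"
      using less(1)[of ?K' p] exchange_cluster[OF ex] by blast
    have "reach (num_central s K - 1) K M"
      using reach_exchange[OF ex M(2)] cnt cnt' pos by simp
    then show ?thesis using M by blast
  qed
qed

lemma nat_n_ge: "nat n \<ge> 2" using n_ge by simp

lemma reach_opposite:
  assumes K: "cluster K" and C: "Cen s p \<in> K" "\<And>k. Cen (\<not> s) k \<notin> K"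
    and K': "cluster K'" "Cen (\<not> s) p' \<in> K'"
    and le: "num_central s K \<le> num_central (\<not> s) K'"
  shows "reach (2 * nat n - 2) K K'"
proof -
  obtain M q where M: "cluster M" "reach (num_central s K - 1) K M" "Cen (\<not> s) q \<in> M"
    using reach_mixed[OF K C] by blast
  have pos: "num_central (\<not> s) M > 0" using num_central_pos_iff[OF clusterD(1)[OF M(1)]] M(3) by blast
  have pos': "num_central s K > 0" using num_central_pos_iff[OF clusterD(1)[OF K]] C(1) by blast
  have "reach (nat n - 1) M (all_central (\<not> s))"
    by (rule reach_mono[OF reach_all_central[OF M(1,3)]]) (use pos in simp)
  from reach_trans[OF reach_trans[OF M(2) this] reach_sym[OF reach_all_central[OF K']]]
  show ?thesis
    by (rule reach_mono) (use le pos' nat_n_ge num_central_le[of "\<not> s" K'] in linarith)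
qed

lemma reach_upper_bound:
  assumes K: "cluster K" and K': "cluster K'" shows "reach (2 * nat n - 2) K K'"
proof -
  have both: ?thesis if "Cen s p \<in> K" "Cen s p' \<in> K'" for s p p'
  proof -
    have "num_central s K > 0" "num_central s K' > 0"
      using num_central_pos_iff[OF clusterD(1)[OF K]] num_central_pos_iff[OF clusterD(1)[OF K']] that by blast+
    then show ?thesis
      using reach_mono[OF reach_trans[OF reach_all_central[OF K that(1)] reach_sym[OF reach_all_central[OF K' that(2)]]]]
      by simp
  qed
  obtain s p where C: "Cen s p \<in> K" using cluster_has_Cen[OF K] .
  obtain s' p' where C': "Cen s' p' \<in> K'" using cluster_has_Cen[OF K'] .
  show ?thesis
  proof (cases "(\<exists>k. Cen s k \<in> K') \<or> (\<exists>k. Cen s' k \<in> K)")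
    case True
    then show ?thesis using both C C' by blast
  next
    case False
    then have s': "s' = (\<not> s)" using C' by (cases "s' = s") auto
    have s: "s = (\<not> s')" using s' by simp
    show ?thesis
    proof (cases "num_central s K \<le> num_central s' K'")
      case True
      then show ?thesis using reach_opposite[OF K C _ K'(1)] C' False unfolding s' by blast
    next
      case f: False
      then have "reach (2 * nat n - 2) K' K"
        using reach_opposite[OF K' C' _ K(1)] C False f unfolding s by simp
      then show ?thesis by (rule reach_sym)
    qed
  qed
qed

text \<open>
  A lower bound for the distance from \<open>all_central True\<close>. It grows by at most one in a flip that
  creates the first chord on side \<open>False\<close>, because at most two pairs can be left on side \<open>True\<close>.
\<close>

definition potential :: "chord_index set \<Rightarrow> nat" where
  "potential K = (if num_central False K = 0 then nat n - num_central True K else nat n + num_central False K - 2)"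

text \<open>One chord on the other side forces all chords on side \<open>s\<close> to be congruent
  to it, hence into a single orbit.\<close>

lemma mixed_counts:
  assumes K: "cluster K" and "num_central True K > 0" "num_central False K > 0"
  shows "num_central s K = 1"
proof -
  have sc: "shift_closed K" by (rule clusterD(1)[OF K])
  obtain k k' where k: "Cen s k \<in> K" "Cen (\<not> s) k' \<in> K"
    using assms num_central_pos_iff[OF sc, of True] num_central_pos_iff[OF sc, of False] by (cases s) auto
  have "Cen s a \<in> K \<longleftrightarrow> Cen s a \<in> orbit (Cen s k')" for a
  proof -
    have "Cen s a \<in> K \<Longrightarrow> n dvd a - k'" using clusterD(3)[OF K _ k(2)] by blast
    moreover have "n dvd k - k'" using clusterD(3)[OF K k] .
    then have "Cen s k' \<in> K" using Cen_cong[OF sc] k(1) by blast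
    then have "n dvd a - k' \<Longrightarrow> Cen s a \<in> K" using Cen_cong[OF sc, of a k' s] by blast
    ultimately show ?thesis unfolding Cen_orbit_iff by blast
  qed
  then have "num_central s K = card {a \<in> {0..<n}. Cen s a \<in> orbit (Cen s k')}"
    unfolding num_central_def by simp
  then show ?thesis unfolding Cen_orbit_residue by simp
qed

lemma potential_exchange:
  assumes "exchange K K'" shows "potential K' \<le> Suc (potential K)"
proof -
  have K: "cluster K" "cluster K'" using exchange_cluster[OF assms] by auto
  note cnt = exchange_num_central[OF assms, of True] exchange_num_central[OF assms, of False]
  show ?thesis
  proof (cases "num_central False K = 0 \<and> num_central False K' > 0")
    case True
    \<comment> \<open>Either side \<open>True\<close> has disappeared from \<open>K'\<close>, or
      both sides occur and \<open>mixed_counts\<close> applies.\<close>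
    then have "num_central True K' \<le> 1" using mixed_counts[OF K(2), of True] by fastforce
    then have "num_central True K \<le> 2" using cnt by simp
    moreover have "num_central False K' = 1" using True cnt by simp
    ultimately show ?thesis using True nat_n_ge by (simp add: potential_def)
  next
    case False
    then show ?thesis using cnt nat_n_ge unfolding potential_def by auto
  qed
qed

lemma potential_all_central: "potential (all_central True) = 0" "potential (all_central False) = 2 * nat n - 2"
  using num_central_all_central[of True] num_central_all_central[of False] num_central_all_central_other[of True] nat_n_ge
  by (simp_all add: potential_def mult_2)

end

section \<open>Crossings of segments\<close>

locale disk_configuration =
  fixes n :: nat and r :: real
  assumes n_ge_2: "n \<ge> 2" and admissible: "admissible_radius n r"
begin

definition V :: "int \<Rightarrow> complex" where
  "V k = cis (pi * of_int k / real n)"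

text \<open>In the right triangle formed by the centre, a point of tangency and a vertex, the leg is
  \<open>r\<close> and the hypotenuse 1, so the angle at the centre is
  \<open>arccos r\<close>.\<close>

definition tangent_angle :: "bool \<Rightarrow> real" where
  "tangent_angle s = (if s then arccos r else - arccos r)"

definition touch :: "bool \<Rightarrow> int \<Rightarrow> complex" where
  "touch s k = V k * (of_real r * cis (tangent_angle s))"

text \<open>
  \<open>height i j\<close> is the coordinate orthogonal to the chord from \<open>V i\<close> to \<open>V j\<close>, whose line is
  \<open>height i j z = level i j\<close>; the disk lies strictly below this line.
\<close>

definition height :: "int \<Rightarrow> int \<Rightarrow> complex \<Rightarrow> real" where
  "height i j z = Re (z * cis (- (pi * of_int (i + j) / (2 * real n))))"

definition level :: "int \<Rightarrow> int \<Rightarrow> real" where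
  "level i j = cos (pi * of_int (j - i) / (2 * real n))"

section \<open>Vertices, tangent points and heights\<close>

lemma n_pos_real: "real n > 0" using n_ge_2 by simp

lemma r_pos: "r > 0" using admissible unfolding admissible_radius_def by blast

lemma V_norm [simp]: "norm (V k) = 1" by (simp add: V_def)

lemma V_vertex: "vertex n k = V (int k)"
  by (simp add: V_def vertex_def)

lemma V_add_n: "V (k + int n) = - V k"
proof -
  have "pi * of_int (k + int n) / real n = pi * of_int k / real n + pi"
    using n_pos_real by (simp add: field_simps)
  then show ?thesis unfolding V_def by (simp add: cis_mult[symmetric])
qed

lemma V_eq_iff: "V k = V k' \<longleftrightarrow> 2 * int n dvd k - k'"
proof -
  have "V k = V k' \<longleftrightarrow> (\<exists>m::int. pi * of_int k / real n = pi * of_int k' / real n + 2 * pi * of_int m)"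
    unfolding V_def complex_eq_iff cis.sel using sin_cos_eq_iff by blast
  also have "\<dots> \<longleftrightarrow> (\<exists>m::int. real_of_int k = of_int k' + 2 * real n * of_int m)"
  proof (rule ex_cong1)
    fix m :: int
    have "pi * of_int k / real n = pi * of_int k' / real n + 2 * pi * of_int m \<longleftrightarrow>
        pi * of_int k = pi * (of_int k' + 2 * real n * of_int m)"
      using n_pos_real by (simp add: field_simps)
    then show "pi * of_int k / real n = pi * of_int k' / real n + 2 * pi * of_int m \<longleftrightarrow>
        real_of_int k = of_int k' + 2 * real n * of_int m"
      using mult_left_cancel[OF pi_neq_zero] by blast
  qed
  also have "\<dots> \<longleftrightarrow> (\<exists>m::int. k = k' + 2 * int n * m)"
  proof (rule ex_cong1)
    fix m :: int
    have "of_int k' + 2 * real n * of_int m = real_of_int (k' + 2 * int n * m)" by simp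
    then show "real_of_int k = of_int k' + 2 * real n * of_int m \<longleftrightarrow> k = k' + 2 * int n * m"
      by (simp only: of_int_eq_iff)
  qed
  also have "\<dots> \<longleftrightarrow> 2 * int n dvd k - k'"
    by (auto simp: dvd_def algebra_simps)
  finally show ?thesis .
qed

lemma V_periodic: "V (k + 2 * int n * m) = V k"
  by (simp add: V_eq_iff)

lemma half_angle_bounds:
  assumes "0 < d" "d < int n"
  shows "0 < pi * of_int d / (2 * real n)" "pi * of_int d / (2 * real n) < pi / 2"
proof -
  have "real_of_int d < real n" using assms(2) by simp
  then show "0 < pi * of_int d / (2 * real n)" "pi * of_int d / (2 * real n) < pi / 2"
    using assms(1) n_pos_real by (simp_all add: field_simps)
qed

text \<open>The cosine is the distance from the centre to the midpoint of a segment spanning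
  \<open>d\<close> steps, and admissibility keeps that segment away from the disk. For
  \<open>d = 1\<close> the segment is a side of the polygon.\<close>

lemma r_less_cos:
  assumes d: "0 < d" "d < int n" shows "r < cos (pi * of_int d / (2 * real n))"
proof -
  define x where "x = pi * of_int d / (2 * real n)"
  have x: "0 < x" "x < pi / 2" unfolding x_def using half_angle_bounds[OF d] .
  have nd: "0 < nat d" "nat d < n" using d by auto
  have "midpoint (vertex n 0) (vertex n (nat d)) \<in> closed_segment (vertex n 0) (vertex n (nat d))"
    by simp
  moreover have "closed_segment (vertex n 0) (vertex n (nat d)) \<inter> cball 0 r = {}"
    using admissible[unfolded admissible_radius_def, THEN conjunct2, rule_format, of 0 "nat d"] nd by simp
  ultimately have "midpoint (vertex n 0) (vertex n (nat d)) \<notin> cball 0 r" by blast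
  then have "norm (midpoint (vertex n 0) (vertex n (nat d))) > r" by simp
  moreover have "pi * of_int d / real n = 2 * x" unfolding x_def by simp
  then have "vertex n (nat d) = cis (2 * x)" using d by (simp add: vertex_def)
  then have "midpoint (vertex n 0) (vertex n (nat d)) = of_real (cos x) * cis x"
    by (simp add: midpoint_def vertex_def complex_eq_iff cos_double_cos sin_double power2_eq_square)
  then have "norm (midpoint (vertex n 0) (vertex n (nat d))) = \<bar>cos x\<bar>" by (simp add: norm_mult)
  moreover have "cos x > 0" using x by (intro cos_gt_zero) auto
  ultimately show ?thesis unfolding x_def by simp
qed

lemma r_less_1: "r < 1"
  using less_le_trans[OF r_less_cos[of 1] cos_le_one] n_ge_2 by simp

lemma cos_tangent [simp]: "cos (tangent_angle s) = r"
  using r_pos r_less_1 by (simp add: tangent_angle_def)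

lemma sin_tangent: "sin (tangent_angle s) = (if s then sqrt (1 - r\<^sup>2) else - sqrt (1 - r\<^sup>2))"
  using r_pos r_less_1 by (simp add: tangent_angle_def sin_arccos)

lemma r_square_less: "r\<^sup>2 < 1"
  using r_pos r_less_1 by (simp add: power_less_one_iff)

lemma touch_norm: "norm (touch s k) = r"
  using r_pos by (simp add: touch_def norm_mult)

lemma touch_neq_V: "touch s k \<noteq> V k'"
  using touch_norm[of s k] V_norm[of k'] r_less_1 by force

lemma height_linear: "height i j ((1 - u) *\<^sub>R a + u *\<^sub>R b) = (1 - u) * height i j a + u * height i j b"
  by (simp add: height_def algebra_simps)

lemma height_V: "height i j (V k) = cos (pi * of_int (2 * k - i - j) / (2 * real n))"
proof -
  have "pi * of_int k / real n + - (pi * of_int (i + j) / (2 * real n)) = pi * of_int (2 * k - i - j) / (2 * real n)"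
    using n_pos_real by (simp add: field_simps)
  then show ?thesis unfolding height_def V_def cis_mult by simp
qed

lemma height_le_norm: "height i j z \<le> norm z"
proof -
  have "height i j z \<le> norm (z * cis (- (pi * of_int (i + j) / (2 * real n))))"
    unfolding height_def by (rule complex_Re_le_cmod)
  then show ?thesis by (simp add: norm_mult)
qed

lemma height_touch:
  assumes "0 < j - i" "j - i < int n" shows "height i j (touch s k) < level i j"
  using height_le_norm[of i j "touch s k"] r_less_cos[OF assms] by (simp add: touch_norm level_def)

lemma height_ends: "height i j (V i) = level i j" "height i j (V j) = level i j"
proof -
  have "pi * of_int (2 * i - i - j) / (2 * real n) = - (pi * of_int (j - i) / (2 * real n))"
    by (simp add: algebra_simps diff_divide_distrib)
  then show "height i j (V i) = level i j" unfolding height_V level_def by (metis cos_minus)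
qed (simp add: height_V level_def)

text \<open>Measured from the direction of the middle of the arc, \<open>V k\<close> has a smaller
  angle than the ends, and cosine decreases on the interval from 0 to \<open>pi\<close>.\<close>

lemma height_inside:
  assumes "i < k" "k < j" "j - i < int n" shows "height i j (V k) > level i j"
proof -
  define x where "x = pi * real_of_int \<bar>2 * k - i - j\<bar> / (2 * real n)"
  define y where "y = pi * real_of_int (j - i) / (2 * real n)"
  have "0 \<le> x" "x < y" unfolding x_def y_def using assms n_pos_real
    by (auto intro!: divide_strict_right_mono)
  moreover have "y \<le> pi"
    unfolding y_def by (rule less_imp_le, rule less_trans[OF half_angle_bounds(2)]) (use assms in auto)
  ultimately have "cos y < cos x" by (rule cos_monotone_0_pi)
  moreover have "cos x = height i j (V k)"
  proof -
    have "x = \<bar>pi * of_int (2 * k - i - j) / (2 * real n)\<bar>"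
      unfolding x_def using n_pos_real by (simp add: abs_mult)
    then show ?thesis unfolding height_V by (metis cos_abs_real)
  qed
  ultimately show ?thesis unfolding level_def y_def by simp
qed

lemma height_outside:
  assumes "j < k" "k < i + 2 * int n" "0 < j - i" "j - i < int n" shows "height i j (V k) < level i j"
proof -
  define x where "x = pi * real_of_int (2 * k - i - j) / (2 * real n)"
  define y where "y = pi * real_of_int (j - i) / (2 * real n)"
  have "0 < y" "y < pi / 2" unfolding y_def using half_angle_bounds[OF assms(3,4)] .
  then have y: "0 \<le> y" "y \<le> pi" using pi_gt_zero by linarith+
  have "y < x" unfolding x_def y_def using assms n_pos_real
    by (intro divide_strict_right_mono mult_strict_left_mono) auto
  have "x + y = pi * (real_of_int (k - i) / real n)"
    unfolding x_def y_def using n_pos_real by (simp add: field_simps)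
  moreover have "real_of_int (k - i) / real n < 2"
    using assms(2) n_pos_real by (simp add: field_simps)
  then have "pi * (real_of_int (k - i) / real n) < pi * 2" by (intro mult_strict_left_mono) auto
  ultimately have "x < 2 * pi - y" by simp
  \<comment> \<open>Beyond \<open>pi\<close> the angle is replaced by its reflection
    \<open>2 * pi - x\<close>, which still exceeds \<open>y\<close>.\<close>
  have "cos x < cos y"
  proof (cases "x \<le> pi")
    case True
    then show ?thesis using y \<open>y < x\<close> by (intro cos_monotone_0_pi) auto
  next
    case False
    then have "cos (2 * pi - x) < cos y" using y \<open>x < 2 * pi - y\<close> by (intro cos_monotone_0_pi) auto
    then show ?thesis by simp
  qed
  then show ?thesis unfolding height_V level_def x_def y_def .
qed

section \<open>Segments and the line through a diagonal\<close>

lemma open_segment_I: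
  assumes "a \<noteq> b" "0 < u" "u < 1" shows "(1 - u) *\<^sub>R a + u *\<^sub>R b \<in> open_segment a b"
  using assms by (auto simp: in_segment)

lemma crossing_segments_iff:
  assumes "a \<noteq> b" "c \<noteq> d"
  shows "crossing (closed_segment a b) (closed_segment c d) \<longleftrightarrow> open_segment a b \<inter> open_segment c d \<noteq> {}"
  using assms by (simp add: crossing_def rel_interior_closed_segment)

lemma height_open_segment_V:
  assumes "z \<in> open_segment (V i) (V j)" shows "height i j z = level i j"
proof -
  obtain u where "z = (1 - u) *\<^sub>R V i + u *\<^sub>R V j" using assms by (auto simp: in_segment)
  then show ?thesis unfolding \<open>z = _\<close> height_linear height_ends by (simp add: algebra_simps)
qed

text \<open>Interior points of a segment have two positive weights, so strictness at one end already
  keeps them off the line. The other end may lie on it, as happens for chords sharing a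
  vertex.\<close>

lemma same_side_below:
  assumes "height i j a \<le> level i j" "height i j b \<le> level i j"
    and "height i j a < level i j \<or> height i j b < level i j"
  shows "open_segment (V i) (V j) \<inter> open_segment a b = {}"
proof (rule ccontr)
  assume "\<not> ?thesis"
  then obtain z where z: "z \<in> open_segment (V i) (V j)" "z \<in> open_segment a b" by blast
  then obtain u where u: "0 < u" "u < 1" "z = (1 - u) *\<^sub>R a + u *\<^sub>R b" by (auto simp: in_segment)
  have eq: "(1 - u) * height i j a + u * height i j b = level i j"
    using height_open_segment_V[OF z(1)] u(3) height_linear by simp
  have 1: "(1 - u) * height i j a \<le> (1 - u) * level i j" "u * height i j b \<le> u * level i j"
    using assms(1,2) u by (auto intro: mult_left_mono)
  have 2: "(1 - u) * level i j + u * level i j = level i j" by (simp add: algebra_simps)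
  from assms(3) show False
  proof
    assume "height i j a < level i j"
    then have "(1 - u) * height i j a < (1 - u) * level i j" using u by simp
    then show False using eq 1 2 by linarith
  next
    assume "height i j b < level i j"
    then have "u * height i j b < u * level i j" using u by simp
    then show False using eq 1 2 by linarith
  qed
qed

lemma same_side_above:
  assumes "height i j a \<ge> level i j" "height i j b \<ge> level i j"
    and "height i j a > level i j \<or> height i j b > level i j"
  shows "open_segment (V i) (V j) \<inter> open_segment a b = {}"
proof (rule ccontr)
  assume "\<not> ?thesis"
  then obtain z where z: "z \<in> open_segment (V i) (V j)" "z \<in> open_segment a b" by blast
  then obtain u where u: "0 < u" "u < 1" "z = (1 - u) *\<^sub>R a + u *\<^sub>R b" by (auto simp: in_segment)
  have eq: "(1 - u) * height i j a + u * height i j b = level i j"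
    using height_open_segment_V[OF z(1)] u(3) height_linear by simp
  have 1: "(1 - u) * height i j a \<ge> (1 - u) * level i j" "u * height i j b \<ge> u * level i j"
    using assms(1,2) u by (auto intro: mult_left_mono)
  have 2: "(1 - u) * level i j + u * level i j = level i j" by (simp add: algebra_simps)
  from assms(3) show False
  proof
    assume "height i j a > level i j"
    then have "(1 - u) * height i j a > (1 - u) * level i j" using u by simp
    then show False using eq 1 2 by linarith
  next
    assume "height i j b > level i j"
    then have "u * height i j b > u * level i j" using u by simp
    then show False using eq 1 2 by linarith
  qed
qed

lemma V_neq:
  assumes "0 < j - i" "j - i < 2 * int n" shows "V i \<noteq> V j"
  using assms zdvd_imp_le[of "2 * int n" "j - i"] by (auto simp: V_eq_iff dvd_diff_commute)

text \<open>The segment from \<open>a\<close> to \<open>b\<close> meets the line at a point of norm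
  less than 1. Since \<open>V i\<close> and \<open>V j\<close> lie on the unit circle, the part of
  the line in the open unit disk is exactly their open segment.\<close>

lemma opposite_sides:
  assumes ij: "0 < j - i" "j - i < int n" and norm: "norm a \<le> 1" "norm b \<le> 1"
    and a: "height i j a > level i j" and b: "height i j b < level i j"
  shows "open_segment (V i) (V j) \<inter> open_segment a b \<noteq> {}"
proof -
  define u where "u = (height i j a - level i j) / (height i j a - height i j b)"
  have u: "0 < u" "u < 1" unfolding u_def using a b by (auto simp: field_simps)
  define z where "z = (1 - u) *\<^sub>R a + u *\<^sub>R b"
  have "a \<noteq> b" using a b by auto
  then have zab: "z \<in> open_segment a b" unfolding z_def using u by (rule open_segment_I)
  have "dist 0 z < dist 0 a \<or> dist 0 z < dist 0 b" using dist_decreases_open_segment[OF zab] by blast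
  then have "norm z < 1" using norm by auto
  have "u * (height i j a - height i j b) = height i j a - level i j" unfolding u_def using a b by simp
  then have hz: "height i j z = level i j" unfolding z_def height_linear by (simp add: algebra_simps)
  define mid where "mid = pi * of_int (i + j) / (2 * real n)"
  define x where "x = pi * of_int (j - i) / (2 * real n)"
  define w where "w = z * cis (- mid)"
  have x: "0 < x" "x < pi / 2" unfolding x_def using half_angle_bounds[OF ij] by auto
  then have sin: "sin x > 0" by (intro sin_gt_zero) auto
  have "Re w = cos x" using hz unfolding w_def height_def level_def mid_def x_def .
  moreover have "norm w < 1" using \<open>norm z < 1\<close> by (simp add: w_def norm_mult)
  then have "(Re w)\<^sup>2 + (Im w)\<^sup>2 < 1"
    unfolding cmod_power2[symmetric] by (simp add: power_less_one_iff)
  ultimately have "(Im w)\<^sup>2 < (sin x)\<^sup>2" unfolding sin_squared_eq by simp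
  then have "\<bar>Im w\<bar> < sin x" using sin by (metis abs_le_square_iff abs_of_pos not_le)
  then have t: "- 1 < Im w / sin x" "Im w / sin x < 1" using sin by (auto simp: field_simps)
  \<comment> \<open>After rotation the chord is vertical with ends \<open>cis (- x)\<close> and
    \<open>cis x\<close>; \<open>t\<close> is the relative position of \<open>w\<close> between
    them.\<close>
  define t where "t = (Im w / sin x + 1) / 2"
  have t01: "0 < t" "t < 1" unfolding t_def using t by auto
  have "w = (1 - t) *\<^sub>R cis (- x) + t *\<^sub>R cis x"
    using \<open>Re w = cos x\<close> sin by (simp add: complex_eq_iff t_def field_simps)
  then have "w * cis mid = (1 - t) *\<^sub>R (cis (- x) * cis mid) + t *\<^sub>R (cis x * cis mid)"
    by (simp only: distrib_right mult_scaleR_left)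
  moreover have "w * cis mid = z" by (simp add: w_def mult.assoc cis_mult)
  moreover have "cis (- x) * cis mid = V i" "cis x * cis mid = V j"
  proof -
    have "- x + mid = pi * of_int i / real n" "x + mid = pi * of_int j / real n"
      unfolding x_def mid_def using n_pos_real by (simp_all add: field_simps)
    then show "cis (- x) * cis mid = V i" "cis x * cis mid = V j"
      unfolding cis_mult V_def by simp_all
  qed
  ultimately have "z \<in> open_segment (V i) (V j)"
    using open_segment_I[OF V_neq t01, of j i] ij by simp
  then show ?thesis using zab by blast
qed

text \<open>The point at parameter \<open>u\<close> of a central chord, relative to its vertex.\<close>

definition along :: "bool \<Rightarrow> real \<Rightarrow> complex" where
  "along s u = of_real (1 - u) + of_real (u * r) * cis (tangent_angle s)"

lemma Re_along: "Re (along s u) = 1 - u + u * r\<^sup>2"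
  by (simp add: along_def power2_eq_square)

lemma Im_along: "Im (along s u) = u * r * sin (tangent_angle s)"
  by (simp add: along_def)

lemma Re_along_pos: "u < 1 \<Longrightarrow> 0 < u \<Longrightarrow> Re (along s u) > 0"
  using r_pos by (simp add: Re_along add_pos_pos)

lemma along_cnj: "along False u = cnj (along True u)"
  by (simp add: complex_eq_iff Re_along Im_along sin_tangent)

lemma norm_along: "(norm (along s u))\<^sup>2 = 1 - (1 - r\<^sup>2) * (2 * u - u\<^sup>2)"
proof -
  have "(sin (tangent_angle s))\<^sup>2 = 1 - r\<^sup>2"
    using sin_squared_eq[of "tangent_angle s"] by simp
  then have "(norm (along s u))\<^sup>2 = (1 - u + u * r\<^sup>2)\<^sup>2 + u\<^sup>2 * r\<^sup>2 * (1 - r\<^sup>2)"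
    by (simp add: cmod_power2 Re_along Im_along power_mult_distrib)
  also have "\<dots> = 1 - (1 - r\<^sup>2) * (2 * u - u\<^sup>2)"
    by (simp add: power2_eq_square algebra_simps)
  finally show ?thesis .
qed

text \<open>By \<open>norm_along\<close> the distance from the centre does not depend on the side,
  and \<open>2 * u - u^2\<close> is injective below 1. Common points of two central chords therefore
  have the same parameter.\<close>

lemma norm_along_inj:
  assumes "norm (along s u) = norm (along s' u')" "u < 1" "u' < 1" shows "u = u'"
proof -
  have "(1 - r\<^sup>2) * (2 * u - u\<^sup>2) = (1 - r\<^sup>2) * (2 * u' - u'\<^sup>2)"
    using norm_along[of s u] norm_along[of s' u'] unfolding assms(1) by linarith
  then have "2 * u - u\<^sup>2 = 2 * u' - u'\<^sup>2" using r_square_less by simp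
  then have "(u - u') * (2 - u - u') = 0" by (simp add: power2_eq_square algebra_simps)
  then show ?thesis using assms(2,3) by simp
qed

lemma central_point:
  "z \<in> open_segment (V k) (touch s k) \<longleftrightarrow> (\<exists>u. 0 < u \<and> u < 1 \<and> z = V k * along s u)"
proof -
  have "(1 - u) *\<^sub>R V k + u *\<^sub>R touch s k = V k * along s u" for u
    unfolding touch_def along_def scaleR_conv_of_real by (simp add: algebra_simps)
  then show ?thesis using touch_neq_V[of s k k] by (auto simp: in_segment)
qed

text \<open>Such chords are rotations of one another about the centre. At a common point the
  parameters agree, so the rotation fixes a nonzero point and is trivial.\<close>

lemma same_side_tangents:
  assumes "open_segment (V k) (touch s k) \<inter> open_segment (V k') (touch s k') \<noteq> {}"
  shows "2 * int n dvd k - k'"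
proof -
  obtain u u' where u: "0 < u" "u < 1" "0 < u'" "u' < 1" and eq: "V k * along s u = V k' * along s u'"
    using assms by (auto simp: central_point)
  have "norm (along s u) = norm (along s u')" using arg_cong[OF eq, of norm] by (simp add: norm_mult)
  then have "u' = u" using norm_along_inj u by metis
  moreover have "along s u \<noteq> 0" using Re_along_pos[of u s] u by auto
  ultimately have "V k = V k'" using eq by simp
  then show ?thesis by (simp add: V_eq_iff)
qed

lemma V_add: "V (a + b) = V a * V b"
  unfolding V_def cis_mult by (simp add: algebra_simps add_divide_distrib)

text \<open>At a common point the parameters agree, so \<open>V (k' - k)\<close> carries the
  conjugate of \<open>w\<close> to \<open>w\<close>. As \<open>w\<close> lies in the open first
  quadrant, its square has positive imaginary part, hence so has \<open>V (k' - k)\<close>. For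
  multiples of \<open>n\<close> it would be 1 or -1.\<close>

lemma opposite_tangents_meet:
  assumes "open_segment (V k) (touch True k) \<inter> open_segment (V k') (touch False k') \<noteq> {}"
  shows "\<not> int n dvd k' - k"
proof -
  obtain u u' where u: "0 < u" "u < 1" "0 < u'" "u' < 1"
    and eq: "V k * along True u = V k' * along False u'"
    using assms by (auto simp: central_point)
  have "norm (along True u) = norm (along False u')" using arg_cong[OF eq, of norm] by (simp add: norm_mult)
  then have u': "u' = u" using norm_along_inj u by metis
  define w where "w = along True u"
  have "V k' = V k * V (k' - k)" by (simp add: V_add[symmetric])
  then have "V k * w = V k * (V (k' - k) * cnj w)"
    using eq unfolding u' w_def along_cnj by (simp add: mult.assoc)
  moreover have "V k \<noteq> 0" by (simp add: V_def)
  ultimately have "w = V (k' - k) * cnj w" by simp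
  then have "w * w = V (k' - k) * (w * cnj w)" by (metis mult.assoc mult.commute)
  then have "w * w = V (k' - k) * of_real ((norm w)\<^sup>2)" unfolding complex_norm_square .
  then have "Im (w * w) = Im (V (k' - k)) * (norm w)\<^sup>2" by simp
  moreover have "Re w > 0" "Im w > 0"
    using u r_pos r_square_less unfolding w_def Im_along by (simp_all add: Re_along_pos sin_tangent)
  then have "Im (w * w) > 0" by simp
  ultimately have pos: "Im (V (k' - k)) > 0"
    by (metis mult_nonpos_nonneg not_le zero_le_power2)
  define e where "e = (k' - k) mod (2 * int n)"
  have e: "0 \<le> e" "e < 2 * int n" unfolding e_def using n_ge_2 by auto
  have "V e = V (k' - k)" unfolding V_eq_iff e_def by (simp add: mod_eq_dvd_iff[symmetric])
  then have sin: "sin (pi * of_int e / real n) > 0" using pos unfolding \<open>V e = _\<close>[symmetric] by (simp add: V_def)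
  have "e \<noteq> 0" using sin by auto
  moreover have "e < int n"
  proof (rule ccontr)
    assume "\<not> e < int n"
    then have "pi \<le> pi * of_int e / real n" "pi * of_int e / real n < 2 * pi"
      using e n_pos_real by (simp_all add: field_simps)
    then have "sin (pi * of_int e / real n) \<le> 0" by (rule sin_le_zero)
    then show False using sin by simp
  qed
  ultimately have e': "0 < e" "e < int n" using e by auto
  show ?thesis
  proof
    assume "int n dvd k' - k"
    moreover have "int n dvd 2 * int n" by simp
    ultimately have "int n dvd e" unfolding e_def by (simp only: dvd_mod)
    then show False using zdvd_imp_le[of "int n" e] e' by linarith
  qed
qed

text \<open>The two chords are mirror images in the bisector of \<open>V k\<close> and
  \<open>V k'\<close>, so they meet where the first reaches it. It does so because the angle
  \<open>arccos r\<close> of its tangent point exceeds the half angle \<open>x\<close>.\<close>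

lemma opposite_tangents_cross:
  assumes d: "0 < k' - k" "k' - k < int n"
  shows "open_segment (V k) (touch True k) \<inter> open_segment (V k') (touch False k') \<noteq> {}"
proof -
  define x where "x = pi * of_int (k' - k) / (2 * real n)"
  define a where "a = arccos r"
  have x: "0 < x" "x < pi / 2" unfolding x_def using half_angle_bounds[OF d] by auto
  have a: "0 \<le> a" "a \<le> pi" "cos a = r" unfolding a_def using r_pos r_less_1 by (simp_all add: arccos_lbound arccos_ubound)
  have "r < cos x" unfolding x_def using r_less_cos[OF d] .
  then have "x < a" using cos_mono_less_eq[of a x] a x by simp
  have s1: "sin x > 0" using x by (intro sin_gt_zero) auto
  have s2: "sin (a - x) > 0" using x a \<open>x < a\<close> by (intro sin_gt_zero) auto
  define D where "D = sin x + r * sin (a - x)"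
  have D: "D > 0" unfolding D_def using s1 s2 r_pos by (simp add: add_pos_pos)
  \<comment> \<open>With \<open>V k\<close> rotated to 1, this is the solution of
    \<open>Im (w * cis (- x)) = 0\<close>, the parameter at which the chord hits the
    bisector.\<close>
  define u where "u = sin x / D"
  have u: "0 < u" "u < 1" unfolding u_def using D s1 s2 r_pos by (simp_all add: D_def)
  define w where "w = along True u"
  have E: "w * cis (- x) = of_real (1 - u) * cis (- x) + of_real (u * r) * cis (a - x)"
    unfolding w_def along_def tangent_angle_def a_def[symmetric]
    by (simp add: algebra_simps cis_mult)
  have "Im (w * cis (- x)) = - (1 - u) * sin x + u * r * sin (a - x)" unfolding E by (simp add: algebra_simps)
  also have "\<dots> = u * D - sin x" unfolding D_def by (simp add: algebra_simps)
  also have "\<dots> = 0" unfolding u_def using D by simp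
  finally have "w * cis (- x) = of_real (Re (w * cis (- x)))" by (simp add: complex_eq_iff)
  then obtain y where "w * cis (- x) = of_real y" by blast
  then have "w * cis (- x) * cis x = of_real y * cis x" by simp
  then have w: "w = of_real y * cis x" by (simp add: mult.assoc cis_mult)
  then have w': "along False u = of_real y * cis (- x)"
    unfolding along_cnj w_def[symmetric] by (simp add: cis_cnj)
  have "x + x = pi * of_int (k' - k) / real n" unfolding x_def by simp
  then have "V (k' - k) = cis (x + x)" unfolding V_def by simp
  then have "V k' = V k * cis (x + x)" using V_add[of k "k' - k"] by simp
  then have "V k' * along False u = V k * (cis (x + x) * cis (- x)) * of_real y" unfolding w' by simp
  also have "\<dots> = V k * along True u" unfolding cis_mult w_def[symmetric] w by simp
  finally have "V k * along True u = V k' * along False u" by simp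
  then have "V k * along True u \<in> open_segment (V k) (touch True k)"
    "V k * along True u \<in> open_segment (V k') (touch False k')"
    unfolding central_point using u by blast+
  then show ?thesis by blast
qed

section \<open>Crossings that involve a diagonal\<close>

lemma height_periodic: "height i j (V (k + 2 * int n * m)) = height i j (V k)"
  by (simp add: V_periodic)

lemma representative:
  obtains m where "i \<le> k + 2 * int n * m" "k + 2 * int n * m < i + 2 * int n"
proof -
  have "k + 2 * int n * (- ((k - i) div (2 * int n))) = i + (k - i) mod (2 * int n)"
    using mult_div_mod_eq[of "2 * int n" "k - i"] by linarith
  moreover have "0 \<le> (k - i) mod (2 * int n)" "(k - i) mod (2 * int n) < 2 * int n"
    using n_ge_2 by auto
  ultimately show ?thesis using that[of "- ((k - i) div (2 * int n))"] by simp
qed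

text \<open>The tangent point is always below the line of the diagonal, so the side of the vertex
  \<open>V k\<close> decides.\<close>

lemma diagonal_central_iff:
  assumes ij: "0 < j - i" "j - i < int n"
  shows "open_segment (V i) (V j) \<inter> open_segment (V k) (touch s k) \<noteq> {} \<longleftrightarrow>
    (\<exists>m. i < k + 2 * int n * m \<and> k + 2 * int n * m < j)"
proof
  assume "\<exists>m. i < k + 2 * int n * m \<and> k + 2 * int n * m < j"
  then obtain m where "i < k + 2 * int n * m" "k + 2 * int n * m < j" by blast
  then have "height i j (V k) > level i j" using height_inside[of i _ j] ij height_periodic by metis
  then show "open_segment (V i) (V j) \<inter> open_segment (V k) (touch s k) \<noteq> {}"
    using height_touch[OF ij] r_less_1 by (intro opposite_sides[OF ij]) (auto simp: touch_norm)
next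
  assume ne: "open_segment (V i) (V j) \<inter> open_segment (V k) (touch s k) \<noteq> {}"
  obtain m where m: "i \<le> k + 2 * int n * m" "k + 2 * int n * m < i + 2 * int n"
    using representative .
  show "\<exists>m. i < k + 2 * int n * m \<and> k + 2 * int n * m < j"
  proof (rule ccontr)
    assume "\<not> ?thesis"
    then have "k + 2 * int n * m = i \<or> k + 2 * int n * m = j \<or> j < k + 2 * int n * m"
      using m(1) by (metis linorder_neqE_linordered_idom order_le_less)
    then have "height i j (V (k + 2 * int n * m)) \<le> level i j"
      using height_outside[OF _ m(2) ij] height_ends[of i j] by (elim disjE) simp_all
    then show False
      using same_side_below[of i j "V k" "touch s k"] height_touch[OF ij, of s k] ne
      by (simp add: height_periodic)
  qed
qed

lemma diagonals_cross:
  assumes "i < u" "u < j" "j < v" and ij: "j - i < int n" and uv: "v - u < int n"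
  shows "open_segment (V i) (V j) \<inter> open_segment (V u) (V v) \<noteq> {}"
proof (rule opposite_sides)
  show "height i j (V u) > level i j" using height_inside assms by blast
  show "height i j (V v) < level i j" using assms by (intro height_outside) auto
qed (use assms in auto)

text \<open>Open segments can share a point only if the line of one separates the ends of the other
  or contains both of them. Locating the ends on the circle leaves coincidence and the two orders of
  interleaving.\<close>

lemma diagonals_meet:
  assumes ij: "0 < j - i" "j - i < int n" and uv: "0 < v - u" "v - u < int n"
    and ne: "open_segment (V i) (V j) \<inter> open_segment (V u) (V v) \<noteq> {}"
  obtains m where "u + 2 * int n * m = i" "v + 2 * int n * m = j"
  | m where "i < u + 2 * int n * m" "u + 2 * int n * m < j" "j < v + 2 * int n * m"
  | m where "u + 2 * int n * m < i" "i < v + 2 * int n * m" "v + 2 * int n * m < j"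
proof -
  obtain m where m: "i \<le> u + 2 * int n * m" "u + 2 * int n * m < i + 2 * int n"
    using representative .
  define u' v' where "u' = u + 2 * int n * m" and "v' = v + 2 * int n * m"
  have u': "i \<le> u'" "u' < i + 2 * int n" and uv': "0 < v' - u'" "v' - u' < int n"
    using m uv unfolding u'_def v'_def by auto
  have ne': "open_segment (V i) (V j) \<inter> open_segment (V u') (V v') \<noteq> {}"
    using ne unfolding u'_def v'_def V_periodic .
  have below: False if "height i j (V u') \<le> level i j" "height i j (V v') \<le> level i j"
    "height i j (V u') < level i j \<or> height i j (V v') < level i j"
    using same_side_below[OF that] ne' by blast
  have above: False if "height i j (V u') \<ge> level i j" "height i j (V v') \<ge> level i j"
    "height i j (V u') > level i j \<or> height i j (V v') > level i j"
    using same_side_above[OF that] ne' by blast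
  note out = height_outside[OF _ _ ij] and inside = height_inside[OF _ _ ij(2)]
  consider "u' = i" | "i < u'" "u' < j" | "u' = j" | "j < u'" using u' by linarith
  then show ?thesis
  proof cases
    case 1
    consider "v' = j" | "v' < j" | "j < v'" by linarith
    then show ?thesis
    proof cases
      case 1
      then show ?thesis using that(1)[of m] \<open>u' = i\<close> unfolding u'_def v'_def by blast
    next
      case 2
      then have "height i j (V v') > level i j" using inside \<open>u' = i\<close> uv' by simp
      then show ?thesis using above \<open>u' = i\<close> height_ends(1)[of i j] by simp
    next
      case 3
      then have "height i j (V v') < level i j" using out \<open>u' = i\<close> uv' by simp
      then show ?thesis using below \<open>u' = i\<close> height_ends(1)[of i j] by simp
    qed
  next
    case 2
    have u: "height i j (V u') > level i j" using inside 2 by blast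
    consider "v' = j" | "v' < j" | "j < v'" by linarith
    then show ?thesis
    proof cases
      case 1
      then show ?thesis using above u height_ends(2)[of i j] by simp
    next
      case 2
      then have "height i j (V v') > level i j" using inside u' uv' by simp
      then show ?thesis using above u by simp
    next
      case 3
      then show ?thesis using that(2)[of m] 2 unfolding u'_def v'_def by blast
    qed
  next
    case 3
    then have "height i j (V v') < level i j" using uv' ij by (intro out) auto
    then show ?thesis using below height_ends(2)[of i j] 3 by simp
  next
    case 4
    have u: "height i j (V u') < level i j" using u' 4 by (intro out) auto
    \<comment> \<open>Starting beyond \<open>j\<close>, the second arc may run past
      \<open>i + 2 * int n\<close>; its end is then compared with \<open>i\<close> and
      \<open>j\<close> one turn earlier.\<close>
    have shift: "height i j (V v') = height i j (V (v' - 2 * int n))"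
      using height_periodic[of i j v' "-1"] by simp
    consider "v' - 2 * int n < i" | "v' - 2 * int n = i" | "i < v' - 2 * int n" "v' - 2 * int n < j"
      | "v' - 2 * int n = j" | "j < v' - 2 * int n" by linarith
    then show ?thesis
    proof cases
      case 1
      then have "height i j (V v') < level i j" using 4 uv' by (intro out) auto
      then show ?thesis using below u by simp
    next
      case 2
      then show ?thesis using below u shift height_ends(1)[of i j] by simp
    next
      case 3
      have "u + 2 * int n * (m - 1) = u' - 2 * int n" "v + 2 * int n * (m - 1) = v' - 2 * int n"
        unfolding u'_def v'_def by (simp_all add: algebra_simps)
      then show ?thesis using that(3)[of "m - 1"] u' 3 by simp
    next
      case 4
      then show ?thesis using below u shift height_ends(2)[of i j] by simp
    next
      case 5
      then have "height i j (V (v' - 2 * int n)) < level i j" using u' uv' by (intro out) auto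
      then show ?thesis using below u shift by simp
    qed
  qed
qed

end

section \<open>Pseudotriangulations and the diameter\<close>

sublocale disk_configuration \<subseteq> cyclic_size "int n"
  by unfold_locales (use n_ge_2 in simp)

context disk_configuration
begin

section \<open>From chord indices to segments\<close>

fun seg :: "chord_index \<Rightarrow> complex set" where
  "seg (Cen s k) = closed_segment (V k) (touch s k)"
| "seg (Dia i j) = closed_segment (V i) (V j)"

lemma V_shift: "V (k + m * int n) = (if even m then V k else - V k)"
proof (cases "even m")
  case True
  then obtain l where "m = 2 * l" by blast
  then show ?thesis using V_periodic[of k l] True by (simp add: algebra_simps)
next
  case False
  then obtain l where "m = 2 * l + 1" by (elim oddE)
  then have "k + m * int n = (k + int n) + 2 * int n * l" by (simp add: algebra_simps)
  then have "V (k + m * int n) = - V k" by (simp only: V_periodic V_add_n)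
  then show ?thesis using False by simp
qed

lemma touch_shift: "touch s (k + m * int n) = (if even m then touch s k else - touch s k)"
  by (simp add: touch_def V_shift)

lemma uminus_segment: "uminus ` closed_segment a b = closed_segment (- a) (- b :: complex)"
  by (rule closed_segment_linear_image[symmetric]) (simp add: linear_uminus)

lemma seg_shift: "seg (shift m c) = (if even m then seg c else uminus ` seg c)"
  by (cases c) (simp_all add: V_shift touch_shift uminus_segment)

lemma touch_sign: "touch s k = touch s' k \<Longrightarrow> s = s'"
proof -
  assume "touch s k = touch s' k"
  then have "cis (tangent_angle s) = cis (tangent_angle s')"
    using r_pos by (simp add: touch_def V_def)
  then have "sin (tangent_angle s) = sin (tangent_angle s')" by (metis cis.sel(2))
  moreover have "sqrt (1 - r\<^sup>2) > 0" using r_square_less by simp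
  ultimately show "s = s'" unfolding sin_tangent by (auto split: if_splits)
qed

lemma dvd_2n_shift: "2 * int n dvd a - b \<Longrightarrow> \<exists>m. a = b + (2 * m) * int n"
  by (auto simp: dvd_def algebra_simps)

text \<open>A segment determines its ends, and a tangent point has norm below 1, so it is never a
  vertex. Equal diagonals with reversed ends would make two short arcs add up to a full
  turn.\<close>

lemma seg_eqD:
  assumes "valid c" "valid d" "seg c = seg d" obtains m where "c = shift (2 * m) d"
proof (cases c; cases d)
  fix s k s' k' assume cd: "c = Cen s k" "d = Cen s' k'"
  then have "{V k, touch s k} = {V k', touch s' k'}" using assms(3) by simp
  then have "V k = V k'" "touch s k = touch s' k'"
    using touch_neq_V by (auto simp: doubleton_eq_iff)
  moreover from this have "touch s' k = touch s' k'" by (simp add: touch_def)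
  ultimately have "s = s'" "2 * int n dvd k - k'" using touch_sign[of s k s'] by (simp_all add: V_eq_iff)
  then show ?thesis using that dvd_2n_shift[of k k'] cd by auto
next
  fix s k i j assume "c = Cen s k" "d = Dia i j"
  then have "touch s k \<in> {V i, V j}" using assms(3) by auto
  then show ?thesis using touch_neq_V by auto
next
  fix s k i j assume "c = Dia i j" "d = Cen s k"
  then have "touch s k \<in> {V i, V j}" using assms(3) by auto
  then show ?thesis using touch_neq_V by auto
next
  fix i j u v assume cd: "c = Dia i j" "d = Dia u v"
  have len: "2 \<le> j - i" "j - i < int n" "2 \<le> v - u" "v - u < int n" using assms(1,2) cd by auto
  have "{V i, V j} = {V u, V v}" using assms(3) cd by simp
  then consider "V i = V u" "V j = V v" | "V i = V v" "V j = V u" by (auto simp: doubleton_eq_iff)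
  then show ?thesis
  proof cases
    case 1
    then have d: "2 * int n dvd i - u" "2 * int n dvd j - v" by (simp_all add: V_eq_iff)
    from dvd_diff[OF d(2,1)] have dvd: "2 * int n dvd (j - i) - (v - u)" by (simp add: algebra_simps)
    have "(j - i) - (v - u) = 0"
    proof (rule ccontr)
      assume "(j - i) - (v - u) \<noteq> 0"
      from dvd_imp_le_int[OF this dvd] show False using len by linarith
    qed
    moreover obtain m where "i = u + (2 * m) * int n" using dvd_2n_shift[OF d(1)] by blast
    ultimately show ?thesis using that[of m] cd by simp
  next
    case 2
    then have d: "2 * int n dvd i - v" "2 * int n dvd j - u" by (simp_all add: V_eq_iff)
    from dvd_diff[OF d(2,1)] have "2 * int n dvd (j - i) + (v - u)" by (simp add: algebra_simps)
    then have "2 * int n \<le> (j - i) + (v - u)" by (rule zdvd_imp_le) (use len in linarith)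
    then show ?thesis using len by linarith
  qed
qed

section \<open>Geometric crossings and integer compatibility\<close>

lemma crossing_sym: "crossing c d \<longleftrightarrow> crossing d c"
  by (simp add: crossing_def Int_commute)

lemma V_neq_valid: "valid (Dia i j) \<Longrightarrow> V i \<noteq> V j"
  using V_neq[of j i] by simp

lemma crossing_seg_simps:
  "crossing (seg (Cen s k)) (seg (Cen s' k')) \<longleftrightarrow> open_segment (V k) (touch s k) \<inter> open_segment (V k') (touch s' k') \<noteq> {}"
  "valid (Dia i j) \<Longrightarrow> crossing (seg (Dia i j)) (seg (Cen s k)) \<longleftrightarrow> open_segment (V i) (V j) \<inter> open_segment (V k) (touch s k) \<noteq> {}"
  "valid (Dia i j) \<Longrightarrow> valid (Dia u v) \<Longrightarrow> crossing (seg (Dia i j)) (seg (Dia u v)) \<longleftrightarrow> open_segment (V i) (V j) \<inter> open_segment (V u) (V v) \<noteq> {}"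
  using crossing_segments_iff V_neq_valid touch_neq_V unfolding seg.simps by (metis, metis, metis)

text \<open>A chord crosses itself in the sense of \<open>crossing\<close>. Distinctness is built in
  to match \<open>pairwise\<close>, and it is stated for segments because different indices may
  denote the same one.\<close>

definition clash :: "chord_index \<Rightarrow> chord_index \<Rightarrow> bool" where
  "clash c d \<longleftrightarrow> seg c \<noteq> seg d \<and> crossing (seg c) (seg d)"

lemma clash_sym: "clash c d \<longleftrightarrow> clash d c"
  using crossing_sym by (auto simp: clash_def)

text \<open>A suitable translate brings the difference of the two positions to a residue strictly
  between 0 and \<open>n\<close>, where opposite tangents do cross.\<close>

lemma clash_tangents:
  "(\<exists>m. clash (Cen s (k + m * int n)) (Cen s' k')) \<longleftrightarrow> s \<noteq> s' \<and> \<not> int n dvd k' - k"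
proof -
  have same: "\<not> clash (Cen s k) (Cen s k')" for s k k'
  proof
    assume a: "clash (Cen s k) (Cen s k')"
    then have "2 * int n dvd k - k'" using same_side_tangents unfolding clash_def crossing_seg_simps by blast
    then have "V k = V k'" by (simp add: V_eq_iff)
    then show False using a by (simp add: clash_def touch_def)
  qed
  have neq: "seg (Cen True k) \<noteq> seg (Cen False k')" for k k'
    using seg_eqD[of "Cen True k" "Cen False k'"] by auto
  have tf: "clash (Cen True k) (Cen False k') \<longrightarrow> \<not> int n dvd k' - k"
    "0 < k' - k \<Longrightarrow> k' - k < int n \<Longrightarrow> clash (Cen True k) (Cen False k')" for k k'
    using opposite_tangents_meet opposite_tangents_cross neq unfolding clash_def crossing_seg_simps by blast+
  have rem: "0 < a mod int n \<and> a mod int n < int n" if "\<not> int n dvd a" for a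
  proof -
    have "a mod int n \<noteq> 0" using that by (meson mod_0_imp_dvd)
    then show ?thesis using pos_mod_sign[OF n_pos, of a] pos_mod_bound[OF n_pos, of a] by linarith
  qed
  have res: "a + (- (a div int n)) * int n = a mod int n" for a
    using div_mult_mod_eq[of a "int n"] by linarith
  have dv: "int n dvd k' - (k + m * int n) \<longleftrightarrow> int n dvd k' - k" for m k k'
  proof -
    have "k' - (k + m * int n) = (k' - k) + int n * (- m)" by (simp add: algebra_simps)
    then show ?thesis by (metis dvd_add_left_iff dvd_triv_left)
  qed
  show ?thesis
  proof (cases "s = s'")
    case True
    then show ?thesis using same by blast
  next
    case False
    then consider "s" "\<not> s'" | "\<not> s" "s'" by blast
    then show ?thesis
    proof cases
      case 1
      have "\<exists>m. clash (Cen True (k + m * int n)) (Cen False k')" if "\<not> int n dvd k' - k"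
      proof -
        have "k' - (k + ((k' - k) div int n) * int n) = (k' - k) mod int n"
          using res[of "k' - k"] by simp
        then show ?thesis using tf(2)[of k' "k + ((k' - k) div int n) * int n"] rem[OF that] by metis
      qed
      moreover have "\<not> int n dvd k' - k" if "clash (Cen True (k + m * int n)) (Cen False k')" for m
        using tf(1)[of "k + m * int n" k'] that dv by blast
      ultimately show ?thesis using 1 by auto
    next
      case 2
      have "\<exists>m. clash (Cen False (k + m * int n)) (Cen True k')" if "\<not> int n dvd k' - k"
      proof -
        have "\<not> int n dvd k - k'" using that dvd_diff_commute by blast
        moreover have "(k + (- ((k - k') div int n)) * int n) - k' = (k - k') mod int n"
          using res[of "k - k'"] by simp
        ultimately show ?thesis
          using tf(2)[of "k + (- ((k - k') div int n)) * int n" k'] rem[of "k - k'"] clash_sym by metis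
      qed
      moreover have "\<not> int n dvd k' - k" if "clash (Cen False (k + m * int n)) (Cen True k')" for m
        using tf(1)[of k' "k + m * int n"] that dv clash_sym dvd_diff_commute[of "int n"] by metis
      ultimately show ?thesis using 2 by auto
    qed
  qed
qed

text \<open>Segments repeat with period \<open>2n\<close> but orbits with period \<open>n\<close>;
  quantifying over the orbit absorbs the coarser period.\<close>

lemma split_parity: "(\<exists>m. P (a + m * int n)) \<longleftrightarrow> (\<exists>m l. P (a + m * int n + 2 * int n * l))" for a :: int
proof
  assume "\<exists>m. P (a + m * int n)"
  then obtain m where "P (a + m * int n + 2 * int n * 0)" by auto
  then show "\<exists>m l. P (a + m * int n + 2 * int n * l)" by blast
next
  assume "\<exists>m l. P (a + m * int n + 2 * int n * l)"
  then obtain m l where "P (a + m * int n + 2 * int n * l)" by blast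
  moreover have "a + m * int n + 2 * int n * l = a + (m + 2 * l) * int n" by (simp add: algebra_simps)
  ultimately show "\<exists>m. P (a + m * int n)" by metis
qed

lemma clash_diagonal_tangent:
  assumes "valid (Dia i j)"
  shows "(\<exists>m. clash (Dia i j) (Cen s (k + m * int n))) \<longleftrightarrow> (\<exists>m. i < k + m * int n \<and> k + m * int n < j)"
proof -
  have neq: "seg (Dia i j) \<noteq> seg (Cen s k)" for k
    using seg_eqD[OF assms, of "Cen s k"] by auto
  have ij: "0 < j - i" "j - i < int n" using assms by auto
  have "clash (Dia i j) (Cen s k) \<longleftrightarrow> (\<exists>l. i < k + 2 * int n * l \<and> k + 2 * int n * l < j)" for k
    unfolding clash_def crossing_seg_simps(2)[OF assms] diagonal_central_iff[OF ij] using neq by blast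
  then show ?thesis using split_parity[of "\<lambda>k. i < k \<and> k < j" k] by simp
qed

lemma clash_diagonals:
  assumes ij: "valid (Dia i j)" and uv: "valid (Dia u v)"
  shows "(\<exists>m. clash (Dia i j) (Dia (u + m * int n) (v + m * int n))) \<longleftrightarrow>
    (\<exists>m. i < u + m * int n \<and> u + m * int n < j \<and> j < v + m * int n \<or>
         u + m * int n < i \<and> i < v + m * int n \<and> v + m * int n < j)"
proof
  assume "\<exists>m. clash (Dia i j) (Dia (u + m * int n) (v + m * int n))"
  then obtain m where m: "clash (Dia i j) (Dia (u + m * int n) (v + m * int n))" by blast
  have uv': "valid (Dia (u + m * int n) (v + m * int n))" using uv by simp
  have len: "0 < j - i" "j - i < int n" "0 < v + m * int n - (u + m * int n)" "v + m * int n - (u + m * int n) < int n"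
    using ij uv by auto
  have ne: "open_segment (V i) (V j) \<inter> open_segment (V (u + m * int n)) (V (v + m * int n)) \<noteq> {}"
    using m unfolding clash_def crossing_seg_simps(3)[OF ij uv'] by blast
  have reshift: "a + m * int n + 2 * int n * l = a + (m + 2 * l) * int n" for a l
    by (simp add: algebra_simps)
  show "\<exists>m. i < u + m * int n \<and> u + m * int n < j \<and> j < v + m * int n \<or>
         u + m * int n < i \<and> i < v + m * int n \<and> v + m * int n < j"
  proof (rule diagonals_meet[OF len ne])
    fix l assume "u + m * int n + 2 * int n * l = i" "v + m * int n + 2 * int n * l = j"
    then have "seg (Dia i j) = seg (Dia (u + m * int n) (v + m * int n))"
      using V_periodic by (metis seg.simps(2))
    then show ?thesis using m by (simp add: clash_def)
  qed (unfold reshift, blast+)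
next
  assume "\<exists>m. i < u + m * int n \<and> u + m * int n < j \<and> j < v + m * int n \<or>
         u + m * int n < i \<and> i < v + m * int n \<and> v + m * int n < j"
  then obtain m where m: "i < u + m * int n \<and> u + m * int n < j \<and> j < v + m * int n \<or>
         u + m * int n < i \<and> i < v + m * int n \<and> v + m * int n < j" by blast
  define u' v' where "u' = u + m * int n" and "v' = v + m * int n"
  have uv': "valid (Dia u' v')" using uv unfolding u'_def v'_def by simp
  have len: "j - i < int n" "v' - u' < int n" using ij uv' by auto
  have cr: "clash (Dia i j) (Dia u v)"
    if "i < u" "u < j" "j < v" "valid (Dia i j)" "valid (Dia u v)" for i j u v
  proof -
    have "seg (Dia i j) \<noteq> seg (Dia u v)"
    proof
      assume "seg (Dia i j) = seg (Dia u v)"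
      then have "V u \<in> {V i, V j}" by auto
      moreover have "height i j (V u) > level i j" using that by (intro height_inside) auto
      ultimately show False using height_ends[of i j] by auto
    qed
    moreover have "open_segment (V i) (V j) \<inter> open_segment (V u) (V v) \<noteq> {}"
      using that by (intro diagonals_cross) auto
    ultimately show ?thesis unfolding clash_def crossing_seg_simps(3)[OF that(4,5)] by blast
  qed
  have "clash (Dia i j) (Dia u' v')"
    using m cr[of i u' j v'] cr[of u' i v' j] ij uv' clash_sym unfolding u'_def[symmetric] v'_def[symmetric] by blast
  then show "\<exists>m. clash (Dia i j) (Dia (u + m * int n) (v + m * int n))"
    unfolding u'_def v'_def by blast
qed

lemma seg_uminus_clash: "clash (shift m c) (shift m d) \<longleftrightarrow> clash c d"
proof -
  have "crossing (uminus ` A) (uminus ` B) \<longleftrightarrow> crossing A B" for A B :: "complex set"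
  proof -
    have "rel_interior (uminus ` C) = uminus ` rel_interior C" for C :: "complex set"
      by (rule rel_interior_injective_linear_image) (auto simp: bounded_linear_minus[OF bounded_linear_ident] inj_def)
    then show ?thesis by (auto simp: crossing_def)
  qed
  moreover have "inj (\<lambda>A. uminus ` A :: complex set)" by (rule injI) (metis uminus_image_uminus_image)
  ultimately show ?thesis unfolding clash_def seg_shift by (auto dest: injD)
qed

lemma ex_shift_swap: "(\<exists>m. clash (shift m c) d) \<longleftrightarrow> (\<exists>m. clash (shift m d) c)"
proof -
  have "\<exists>m. clash (shift m d) c" if "clash (shift m c) d" for m c d
    using that seg_uminus_clash[of "- m" "shift m c" d] clash_sym by auto
  then show ?thesis by blast
qed

text \<open>The integer conditions detect crossings only up to translation: two incompatible
  tangents, for example, may cross only after one is moved to its mirror image through the centre.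
  The equivalence is therefore stated for a whole orbit.\<close>

lemma compatible_orbit_clash:
  assumes "valid c" "valid d"
  shows "compatible (orbit c) d \<longleftrightarrow> (\<forall>e\<in>orbit c. \<not> clash e d)"
proof -
  have "(\<forall>e\<in>orbit c. \<not> clash e d) \<longleftrightarrow> \<not> (\<exists>m. clash (shift m c) d)"
    unfolding orbit_def by blast
  moreover have "compatible (orbit c) d \<longleftrightarrow> \<not> (\<exists>m. clash (shift m c) d)"
  proof (cases c; cases d)
    fix s k s' k' assume "c = Cen s k" "d = Cen s' k'"
    then show ?thesis using clash_tangents[of s k s' k'] by (simp only: compatible_orbit shift.simps) blast
  next
    fix s k i j assume cd: "c = Cen s k" "d = Dia i j"
    then show ?thesis using clash_diagonal_tangent[of i j s k] assms(2) clash_sym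
      unfolding cd compatible_orbit shift.simps by blast
  next
    fix s k i j assume cd: "c = Dia i j" "d = Cen s k"
    have "compatible (orbit c) d \<longleftrightarrow> compatible (orbit d) c" using compatible_orbit_sym by blast
    then show ?thesis using clash_diagonal_tangent[of i j s k] assms(1) clash_sym ex_shift_swap[of c d]
      unfolding cd compatible_orbit shift.simps by blast
  next
    fix i j u v assume cd: "c = Dia i j" "d = Dia u v"
    have "compatible (orbit c) d \<longleftrightarrow> compatible (orbit d) c" using compatible_orbit_sym by blast
    moreover have "compatible (orbit d) c \<longleftrightarrow> \<not> (\<exists>m. clash (shift m d) c)"
      using clash_diagonals[of i j u v] assms clash_sym
      unfolding cd compatible_orbit shift.simps by blast
    ultimately show ?thesis using ex_shift_swap[of c d] by blast
  qed
  ultimately show ?thesis by blast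
qed

lemma compatible_iff_clash:
  assumes "shift_closed A" "\<And>c. c \<in> A \<Longrightarrow> valid c" "valid d"
  shows "compatible A d \<longleftrightarrow> (\<forall>c\<in>A. \<not> clash c d)"
proof -
  have "compatible A d \<longleftrightarrow> (\<forall>c\<in>A. \<forall>e\<in>orbit c. \<not> clash e d)"
    unfolding compatible_orbit_iff[OF assms(1)] using compatible_orbit_clash assms(2,3) by simp
  also have "\<dots> \<longleftrightarrow> (\<forall>c\<in>A. \<not> clash c d)"
  proof -
    have "e \<in> A" if "c \<in> A" "e \<in> orbit c" for c e
      using assms(1) that unfolding shift_closed_def orbit_def by blast
    then show ?thesis using self_in_orbit by blast
  qed
  finally show ?thesis .
qed

text \<open>Rotating \<open>V k\<close> to 1 turns orthogonality into
  \<open>Re y = (norm y)\<^sup>2\<close>. Together with \<open>norm y = r\<close> this fixes the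
  real part and leaves two signs for the imaginary part, one for each side.\<close>

lemma tangent_points:
  "norm t = r \<and> orthogonal t (V k - t) \<longleftrightarrow> (\<exists>s. t = touch s k)"
proof -
  define y where "y = t * cnj (V k)"
  have Vc: "V k * cnj (V k) = 1" by (simp add: complex_norm_square[symmetric])
  then have t: "t = V k * y" unfolding y_def by (metis mult.commute mult.left_commute mult.right_neutral)
  have norm: "norm t = norm y" unfolding t by (simp add: norm_mult)
  have "t \<bullet> V k = Re y" unfolding y_def by (simp add: inner_complex_def)
  then have orth: "orthogonal t (V k - t) \<longleftrightarrow> Re y = (norm y)\<^sup>2"
    unfolding orthogonal_def inner_diff_right norm[symmetric] by (simp add: power2_norm_eq_inner)
  have "touch s k = t \<longleftrightarrow> of_real r * cis (tangent_angle s) = y" for s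
    unfolding touch_def t using V_norm[of k] by (metis mult_cancel_left norm_zero zero_neq_one)
  then have touch: "(\<exists>s. t = touch s k) \<longleftrightarrow> (\<exists>s. y = of_real r * cis (tangent_angle s))" by metis
  have "norm y = r \<and> Re y = (norm y)\<^sup>2 \<longleftrightarrow> Re y = r * r \<and> (Im y)\<^sup>2 = (r * sqrt (1 - r\<^sup>2))\<^sup>2"
  proof -
    have "norm y = r \<longleftrightarrow> (norm y)\<^sup>2 = r\<^sup>2" using r_pos by (simp add: power2_eq_iff_nonneg)
    moreover have "(r * sqrt (1 - r\<^sup>2))\<^sup>2 = r\<^sup>2 - (r * r)\<^sup>2"
      using r_square_less by (simp add: power_mult_distrib algebra_simps power2_eq_square)
    ultimately show ?thesis unfolding cmod_power2 by (auto simp: power2_eq_square)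
  qed
  also have "\<dots> \<longleftrightarrow> (\<exists>s. y = of_real r * cis (tangent_angle s))"
    unfolding power2_eq_iff complex_eq_iff ex_bool_eq by (auto simp: sin_tangent)
  finally show ?thesis unfolding orth touch norm .
qed

lemma residue_2n: obtains k' where "k' < 2 * n" "2 * int n dvd k - int k'"
proof -
  have pos: "2 * int n > 0" using n_ge_2 by simp
  let ?k = "k mod (2 * int n)"
  have "0 \<le> ?k" "?k < 2 * int n" using pos_mod_sign[OF pos, of k] pos_mod_bound[OF pos, of k] .
  moreover have "2 * int n dvd k - ?k" by (rule dvd_minus_mod)
  ultimately show ?thesis using that[of "nat ?k"] by simp
qed

lemma central_chords_eq: "central_chords n r = range (\<lambda>(s, k). seg (Cen s k))"
proof
  show "central_chords n r \<subseteq> range (\<lambda>(s, k). seg (Cen s k))"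
  proof
    fix c assume "c \<in> central_chords n r"
    then obtain k t where c: "c = closed_segment (V (int k)) t" "norm t = r" "orthogonal t (V (int k) - t)"
      unfolding central_chords_def V_vertex by blast
    then obtain s where "t = touch s (int k)" using tangent_points by blast
    then have "c = (\<lambda>(s, k). seg (Cen s k)) (s, int k)" using c by simp
    then show "c \<in> range (\<lambda>(s, k). seg (Cen s k))" by blast
  qed
  show "range (\<lambda>(s, k). seg (Cen s k)) \<subseteq> central_chords n r"
  proof clarify
    fix s k
    obtain k' where k': "k' < 2 * n" "2 * int n dvd k - int k'" using residue_2n .
    have "V k = V (int k')" using k' by (simp add: V_eq_iff)
    then have "seg (Cen s k) = closed_segment (vertex n k') (touch s (int k'))"
      unfolding V_vertex by (simp add: touch_def)
    then show "seg (Cen s k) \<in> central_chords n r"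
      unfolding central_chords_def V_vertex using k' tangent_points[of "touch s (int k')" "int k'"] by blast
  qed
qed

lemma diagonal_chords_eq: "diagonal_chords n = {seg (Dia i j) | i j. valid (Dia i j)}"
proof
  show "diagonal_chords n \<subseteq> {seg (Dia i j) | i j. valid (Dia i j)}"
  proof
    fix c assume "c \<in> diagonal_chords n"
    then obtain i j where ij: "i < j" "j < 2 * n" "j - i \<notin> {1, n, 2 * n - 1}"
      and c: "c = closed_segment (V (int i)) (V (int j))"
      unfolding diagonal_chords_def V_vertex by blast
    show "c \<in> {seg (Dia i j) | i j. valid (Dia i j)}"
    proof (cases "j - i < n")
      case True
      then have "valid (Dia (int i) (int j))" using ij by auto
      moreover have "c = seg (Dia (int i) (int j))" using c by simp
      ultimately show ?thesis by blast
    next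
      case False
      \<comment> \<open>The arc from \<open>i\<close> to \<open>j\<close> is the long one here; the
        short one starts at \<open>j\<close> and ends at \<open>i\<close> one turn later.\<close>
      then have "valid (Dia (int j) (int i + 2 * int n))" using ij by auto
      moreover have "c = seg (Dia (int j) (int i + 2 * int n))"
        using c V_periodic[of "int i" 1] by (simp add: closed_segment_commute)
      ultimately show ?thesis by blast
    qed
  qed
  show "{seg (Dia i j) | i j. valid (Dia i j)} \<subseteq> diagonal_chords n"
  proof clarify
    fix i j assume v: "valid (Dia i j)"
    obtain i' where i': "i' < 2 * n" "2 * int n dvd i - int i'" using residue_2n .
    define j' where "j' = int i' + (j - i)"
    have Vi: "V i = V (int i')" using i' by (simp add: V_eq_iff)
    have Vj: "V j = V j'" unfolding V_eq_iff j'_def using i'(2) by (simp add: algebra_simps)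
    show "seg (Dia i j) \<in> diagonal_chords n"
    proof (cases "j' < 2 * int n")
      case True
      then have "i' < nat j'" "nat j' < 2 * n" "nat j' - i' \<notin> {1, n, 2 * n - 1}"
        using v unfolding j'_def by auto
      moreover have "seg (Dia i j) = closed_segment (vertex n i') (vertex n (nat j'))"
        using Vi Vj v by (simp add: V_vertex j'_def)
      ultimately show ?thesis unfolding diagonal_chords_def by blast
    next
      case False
      \<comment> \<open>The arc passes index 0, so its end becomes the smaller of the two indices in
        the definition of a diagonal.\<close>
      define l where "l = nat (j' - 2 * int n)"
      have l: "int l = j' - 2 * int n" using False unfolding l_def by simp
      have "l < i'" "i' - l \<notin> {1, n, 2 * n - 1}" using v i'(1) l unfolding j'_def by auto
      moreover have "V (int l) = V j'" using V_periodic[of j' "-1"] unfolding l by simp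
      then have "seg (Dia i j) = closed_segment (vertex n l) (vertex n i')"
        using Vi Vj by (simp add: V_vertex closed_segment_commute)
      ultimately show ?thesis unfolding diagonal_chords_def using i'(1) by blast
    qed
  qed
qed

lemma chords_eq: "chords n r = seg ` {c. valid c}"
proof -
  have "seg ` {c. valid c} = {seg (Dia i j) | i j. valid (Dia i j)} \<union> range (\<lambda>(s, k). seg (Cen s k))"
  proof
    show "seg ` {c. valid c} \<subseteq> {seg (Dia i j) | i j. valid (Dia i j)} \<union> range (\<lambda>(s, k). seg (Cen s k))"
    proof clarify
      fix c assume c: "valid c" "seg c \<notin> range (\<lambda>(s, k). seg (Cen s k))"
      then show "\<exists>i j. seg c = seg (Dia i j) \<and> valid (Dia i j)"
      proof (cases c)
        case (Cen s k)
        then have "seg c = (\<lambda>(s, k). seg (Cen s k)) (s, k)" by simp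
        then show ?thesis using c(2) by blast
      qed (use c in blast)
    qed
    have "seg (Cen s k) \<in> seg ` {c. valid c}" for s k by (rule imageI) simp
    then show "{seg (Dia i j) | i j. valid (Dia i j)} \<union> range (\<lambda>(s, k). seg (Cen s k)) \<subseteq> seg ` {c. valid c}"
      by (auto simp del: seg.simps valid.simps)
  qed
  then show ?thesis unfolding chords_def diagonal_chords_eq central_chords_eq by simp
qed

section \<open>Pseudotriangulations as clusters and flips as exchanges\<close>

definition indices :: "complex set set \<Rightarrow> chord_index set" where
  "indices T = {c. valid c \<and> seg c \<in> T}"

lemma seg_shift_in_pair: "seg (shift m c) \<in> cs_pair (seg c)"
  by (cases "even m") (simp_all add: seg_shift cs_pair_def)

lemma seg_in_pair_iff:
  assumes "valid c" "valid d" shows "seg c \<in> cs_pair (seg d) \<longleftrightarrow> c \<in> orbit d"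
proof
  assume "seg c \<in> cs_pair (seg d)"
  then consider "seg c = seg d" | "seg c = seg (shift 1 d)" unfolding cs_pair_def seg_shift by auto
  then show "c \<in> orbit d"
  proof cases
    case 1
    then show ?thesis using seg_eqD[OF assms] in_orbit_iff by metis
  next
    case 2
    then obtain m where "c = shift (2 * m) (shift 1 d)" using seg_eqD[of c "shift 1 d"] assms by auto
    then show ?thesis unfolding in_orbit_iff by auto
  qed
qed (auto simp: in_orbit_iff intro: seg_shift_in_pair)

lemma seg_orbit: "seg ` orbit c = cs_pair (seg c)"
proof -
  have "seg c = seg (shift 0 c)" "uminus ` seg c = seg (shift 1 c)" unfolding seg_shift by simp_all
  then have "cs_pair (seg c) \<subseteq> seg ` orbit c" unfolding cs_pair_def orbit_def by blast
  moreover have "seg ` orbit c \<subseteq> cs_pair (seg c)" unfolding orbit_def using seg_shift_in_pair by blast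
  ultimately show ?thesis by blast
qed

lemma seg_indices:
  assumes "T \<subseteq> chords n r" shows "seg ` indices T = T"
  using assms unfolding chords_eq indices_def by auto

lemma indices_seg:
  assumes "shift_closed K" "\<forall>c\<in>K. valid c" shows "indices (seg ` K) = K"
proof
  show "K \<subseteq> indices (seg ` K)" using assms by (auto simp: indices_def)
  show "indices (seg ` K) \<subseteq> K"
  proof
    fix c assume "c \<in> indices (seg ` K)"
    then obtain d where d: "valid c" "d \<in> K" "seg c = seg d" unfolding indices_def by auto
    then obtain m where "c = shift (2 * m) d" using seg_eqD[of c d] assms by blast
    then show "c \<in> K" using d assms shift_in_iff by blast
  qed
qed

lemma crossing_free_iff:
  assumes "shift_closed K" "\<forall>c\<in>K. valid c"
  shows "crossing_free (seg ` K) \<longleftrightarrow> (\<forall>c\<in>K. compatible K c)"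
proof -
  have "(\<forall>c\<in>K. compatible K c) \<longleftrightarrow> (\<forall>c\<in>K. \<forall>d\<in>K. \<not> clash d c)"
    using compatible_iff_clash[OF assms(1)] assms(2) by blast
  also have "\<dots> \<longleftrightarrow> crossing_free (seg ` K)"
    unfolding crossing_free_def pairwise_def clash_def by blast
  finally show ?thesis by blast
qed

lemma shift_closed_indices:
  assumes "\<forall>c\<in>T. uminus ` c \<in> T" shows "shift_closed (indices T)"
  using assms by (simp add: shift_closed_def indices_def seg_shift)

lemma cluster_indices:
  assumes T: "cs_pseudotriangulation n r T" shows "cluster (indices T)"
proof -
  note T' = T[unfolded cs_pseudotriangulation_def]
  have sub: "T \<subseteq> chords n r" using T' by (rule conjunct1)
  have free: "crossing_free T" using T' by (elim conjE)
  have max: "S = T" if "S \<subseteq> chords n r" "crossing_free S" "T \<subseteq> S" for S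
    using T'[THEN conjunct2, THEN conjunct2, THEN conjunct1, rule_format, of S] that by simp
  have sym: "\<forall>c\<in>T. uminus ` c \<in> T" using T' by (elim conjE)
  let ?K = "indices T"
  have sc: "shift_closed ?K" using shift_closed_indices[OF sym] .
  have val: "\<forall>c\<in>?K. valid c" by (simp add: indices_def)
  have segK: "seg ` ?K = T" using seg_indices[OF sub] .
  have "\<forall>c\<in>?K. compatible ?K c"
    using crossing_free_iff[OF sc val] free unfolding segK by blast
  moreover have "c \<in> ?K" if c: "valid c" "compatible ?K c" for c
  proof -
    have "\<forall>d\<in>?K. \<not> clash d c" using compatible_iff_clash[OF sc _ c(1)] val c(2) by blast
    then have "\<forall>x\<in>seg ` ?K. x \<noteq> seg c \<longrightarrow> \<not> crossing x (seg c)"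
      unfolding clash_def by blast
    then have "\<forall>x\<in>T. x \<noteq> seg c \<longrightarrow> \<not> crossing x (seg c)" unfolding segK .
    \<comment> \<open>The competitors in the maximality condition need not be symmetric, so
      inserting the single segment is enough.\<close>
    then have "crossing_free (insert (seg c) T)"
      using free crossing_sym unfolding crossing_free_def pairwise_insert by blast
    moreover have "insert (seg c) T \<subseteq> chords n r" using sub c(1) unfolding chords_eq by blast
    ultimately have "insert (seg c) T = T" using max by blast
    then show ?thesis using c(1) by (auto simp: indices_def)
  qed
  ultimately show ?thesis using sc val unfolding cluster_def by blast
qed

lemma pseudotriangulation_seg:
  assumes K: "cluster K" shows "cs_pseudotriangulation n r (seg ` K)"
proof -
  have sc: "shift_closed K" using clusterD(1)[OF K] .
  have val: "\<forall>c\<in>K. valid c" and comp: "\<forall>c\<in>K. compatible K c" using K unfolding cluster_def by blast+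
  have "seg ` K \<subseteq> chords n r" using val unfolding chords_eq by blast
  moreover have "crossing_free (seg ` K)" using crossing_free_iff[OF sc val] comp by blast
  moreover have "S = seg ` K" if S: "S \<subseteq> chords n r" "crossing_free S" "seg ` K \<subseteq> S" for S
  proof
    show "S \<subseteq> seg ` K"
    proof
      fix x assume x: "x \<in> S"
      then obtain c where c: "valid c" "x = seg c" using S(1) unfolding chords_eq by blast
      have "\<forall>d\<in>K. \<not> clash d c"
        using S x c unfolding clash_def crossing_free_def pairwise_def by blast
      then have "compatible K c" using compatible_iff_clash[OF sc _ c(1)] val by blast
      then show "x \<in> seg ` K" using cluster_addI[OF K c(1)] c(2) by blast
    qed
  qed (rule S(3))
  moreover have "\<forall>x\<in>seg ` K. uminus ` x \<in> seg ` K"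
  proof clarify
    fix c assume "c \<in> K"
    then have "shift 1 c \<in> K" using sc unfolding shift_closed_def by blast
    moreover have "uminus ` seg c = seg (shift 1 c)" unfolding seg_shift by simp
    ultimately show "uminus ` seg c \<in> seg ` K" by blast
  qed
  ultimately show ?thesis unfolding cs_pseudotriangulation_def by blast
qed

lemma exchange_indices:
  assumes "flip n r T T'" shows "exchange (indices T) (indices T')"
proof -
  obtain x y where T: "cs_pseudotriangulation n r T" "cs_pseudotriangulation n r T'"
    and x: "x \<in> T" and y: "y \<notin> T" and T': "T' = (T - cs_pair x) \<union> cs_pair y"
    using assms unfolding flip_def by blast
  have sub: "T \<subseteq> chords n r" "T' \<subseteq> chords n r"
    using T by (simp_all add: cs_pseudotriangulation_def)
  have "y \<in> T'" unfolding T' cs_pair_def by blast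
  with sub x have "x \<in> seg ` {c. valid c}" "y \<in> seg ` {c. valid c}"
    unfolding chords_eq[symmetric] by blast+
  then obtain c d where c: "valid c" "x = seg c" and d: "valid d" "y = seg d"
    by auto
  have "indices T' = indices T - orbit c \<union> orbit d"
  proof -
    have val: "valid e" if "e \<in> orbit d" for e using that d by (auto simp: in_orbit_iff)
    show ?thesis
    proof (rule set_eqI)
      fix e
      show "e \<in> indices T' \<longleftrightarrow> e \<in> indices T - orbit c \<union> orbit d"
        using seg_in_pair_iff[of e c] seg_in_pair_iff[of e d] c(1) d(1) val[of e]
        unfolding indices_def T' c(2) d(2) by blast
    qed
  qed
  moreover have "c \<in> indices T" "d \<notin> indices T" using c d x y by (auto simp: indices_def)
  ultimately show ?thesis using cluster_indices T d(1) unfolding exchange_def by blast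
qed

lemma flip_seg:
  assumes "exchange K K'" shows "flip n r (seg ` K) (seg ` K')"
proof -
  obtain c d where K: "cluster K" "cluster K'" and c: "c \<in> K" and d: "valid d" "d \<notin> K"
    and K': "K' = K - orbit c \<union> orbit d"
    using assms unfolding exchange_def by blast
  have val: "\<forall>c\<in>K. valid c" using K(1) by (simp add: cluster_def)
  have "seg ` (K - orbit c) = seg ` K - cs_pair (seg c)"
  proof -
    have "seg e \<in> cs_pair (seg c) \<longleftrightarrow> e \<in> orbit c" if "e \<in> K" for e
      using seg_in_pair_iff val c that by blast
    then show ?thesis by auto
  qed
  then have "seg ` K' = seg ` K - cs_pair (seg c) \<union> cs_pair (seg d)"
    unfolding K' image_Un seg_orbit by simp
  moreover have "seg d \<notin> seg ` K"
    using indices_seg[OF clusterD(1)[OF K(1)] val] d unfolding indices_def by blast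
  ultimately show ?thesis unfolding flip_def
    using pseudotriangulation_seg K c by blast
qed

section \<open>Walks in the flip graph and its diameter\<close>

abbreviation "flips \<equiv> with_proj (flip_graph n r)"

lemma flip_graph_sel:
  "pverts (flip_graph n r) = {T. cs_pseudotriangulation n r T}"
  "parcs (flip_graph n r) = {(T, T'). flip n r T T'}"
  by (simp_all add: flip_graph_def)

sublocale flips: wf_digraph flips
  by (rule wf_flip_graph)

lemma potential_walk:
  assumes "flips.awalk T p T'" shows "potential (indices T') \<le> potential (indices T) + length p"
  using assms
proof (induction p arbitrary: T)
  case Nil
  then show ?case by (simp add: flips.awalk_Nil_iff)
next
  case (Cons e p)
  then have e: "flip n r T (snd e)" "flips.awalk (snd e) p T'"
    by (auto simp: flips.awalk_Cons_iff flip_graph_sel)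
  have "potential (indices T') \<le> potential (indices (snd e)) + length p" using Cons.IH e(2) .
  moreover have "potential (indices (snd e)) \<le> Suc (potential (indices T))"
    using potential_exchange exchange_indices e(1) by blast
  ultimately show ?case by simp
qed

lemma walk_of_exchanges:
  assumes "cluster K" "(exchange ^^ j) K K'"
  shows "\<exists>p. flips.awalk (seg ` K) p (seg ` K') \<and> length p = j"
  using assms
proof (induction j arbitrary: K)
  case 0
  then show ?case
    by (intro exI[of _ "[]"]) (simp add: flips.awalk_Nil_iff flip_graph_sel pseudotriangulation_seg)
next
  case (Suc j)
  then obtain L where L: "exchange K L" "(exchange ^^ j) L K'" by (metis relpowp_Suc_D2)
  then obtain p where "flips.awalk (seg ` L) p (seg ` K')" "length p = j"
    using Suc.IH exchange_cluster by blast
  then show ?case using flip_seg[OF L(1)]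
    by (intro exI[of _ "(seg ` K, seg ` L) # p"]) (simp add: flips.awalk_Cons_iff flip_graph_sel)
qed

lemma distance_le:
  assumes "T \<in> verts flips" "T' \<in> verts flips"
  shows "graph_distance flips T T' \<le> ereal (real (2 * n - 2))"
proof -
  have T: "cs_pseudotriangulation n r T" "cs_pseudotriangulation n r T'"
    using assms by (simp_all add: flip_graph_sel)
  then have eq: "seg ` indices T = T" "seg ` indices T' = T'"
    unfolding cs_pseudotriangulation_def by (simp_all add: seg_indices)
  obtain j where j: "j \<le> 2 * n - 2" "(exchange ^^ j) (indices T) (indices T')"
    using reach_upper_bound[OF cluster_indices cluster_indices, OF T] unfolding reach_def by auto
  obtain p where p: "flips.awalk T p T'" "length p = j"
    using walk_of_exchanges[OF cluster_indices[OF T(1)] j(2)] unfolding eq by blast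
  have "graph_distance flips T T' \<le> ereal (real (length p))"
    unfolding graph_distance_flip_graph using p by (intro INF_lower) simp
  also have "\<dots> \<le> ereal (real (2 * n - 2))" using p j by simp
  finally show ?thesis .
qed

lemma distance_ge:
  "ereal (real (2 * n - 2)) \<le> graph_distance flips (seg ` all_central True) (seg ` all_central False)"
proof -
  have ind: "indices (seg ` all_central s) = all_central s" for s
    using cluster_all_central[of s] unfolding cluster_def by (intro indices_seg) blast+
  have "2 * n - 2 \<le> length p" if "flips.awalk (seg ` all_central True) p (seg ` all_central False)" for p
    using potential_walk[OF that] unfolding ind potential_all_central by simp
  then show ?thesis unfolding graph_distance_flip_graph
    by (intro INF_greatest) (simp del: of_nat_diff)
qed

lemma diameter_flips: "diameter_of_graph flips = ereal (2 * real n - 2)"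
proof -
  have "diameter_of_graph flips = ereal (real (2 * n - 2))"
    unfolding diameter_of_graph_def
  proof (rule antisym)
    show "(SUP u\<in>verts flips. SUP v\<in>verts flips. graph_distance flips u v) \<le> ereal (real (2 * n - 2))"
      by (intro SUP_least distance_le)
    have "seg ` all_central s \<in> verts flips" for s
      by (simp add: flip_graph_sel pseudotriangulation_seg cluster_all_central)
    then show "ereal (real (2 * n - 2)) \<le> (SUP u\<in>verts flips. SUP v\<in>verts flips. graph_distance flips u v)"
      by (intro SUP_upper2[of "seg ` all_central True"] SUP_upper2[of "seg ` all_central False"] distance_ge)
  qed
  moreover have "real (2 * n - 2) = 2 * real n - 2" using n_ge_2 by (simp add: of_nat_diff)
  ultimately show ?thesis by simp
qed

end

theorem theorem3p1:
  fixes n :: nat and r :: real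
  assumes "n \<ge> 2" and "admissible_radius n r"
  shows "diameter_of_graph (with_proj (flip_graph n r)) = ereal (2 * real n - 2)"
proof -
  interpret disk_configuration n r by unfold_locales (rule assms)+
  show ?thesis by (rule diameter_flips)
qed

end
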